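(* For $n\ge 1$ let $\ell_n=h_{L_n}(x)$ be the $h$-vector of the quadrangulation $L_n$ of the Lucas family, and set $\ell_0=0$. Then $\ell_1=1+x$ and for all $n\ge 0$ $$\ell_{n+2}=(1+4x+x^2)\,\ell_{n+1}+x(1+x+x^2)\,\ell_n .$$
   Context: Quadrangulations. A quadrangulation is a set of pairwise noncrossing diagonals (inner edges) of a convex polygon with an even number of vertices, cutting it into quadrilaterals (called squares). Two squares are adjacent if they share an inner edge; with this adjacency the squares form a tree. A quadrangulation can be drawn by deforming its squares into regular squares glued along sides. The quadrangulation $L_n$ ($n\ge 1$) has $2n$ squares: it consists of a linear (straight, horizontal) string of $n+1$ squares, consecutive ones being glued so that each non-extreme square of the string has its two neighbours in the string on opposite (left and right) sides, together with one extra square attached to the bottom side of each square of the string except the two extreme ones. Serpents. A serpent in $Q$ is a set of two distinct squares $\{s',s''\}$ (its extremities) such that the unique path of squares from $s'$ to $s''$ makes a right-angle turn in each intermediate square, i.e. never enters and leaves a square through opposite sides. The serpent is also identified with this path, drawn from the centre of $s'$ to the centre of $s''$. Serpent nests. A serpent nest in $Q$ is an equivalence class of sets of serpents in $Q$ satisfying the condition: two serpent extremities may lie in the same square only if the corresponding serpents do not leave this square by the same side. Two such sets are equivalent if the pattern of paths inside every square is the same for both: for each square and each of its four sides, the number of path segments going from this side to the centre (and stopping there) is the same, and for each square and each of its four pairs of adjacent sides, the number of path segments entering by one and leaving by the other is the same. $\mathrm{SN}_Q$ is the set of serpent nests in $Q$. The rank $\operatorname{rk}(\sigma)$ of a serpent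 nest $\sigma$ is the number of serpents in it (half the number of serpent extremities). The $h$-vector of $Q$ is the polynomial $h_Q(x)=\sum_{\sigma\in \mathrm{SN}_Q}x^{\operatorname{rk}(\sigma)}$. *)

theory Defs
  imports "HOL-Computational_Algebra.Polynomial"
begin

(* The convex polygon has the vertices 0, ..., N - 1 in cyclic order, where N = corners Q.
   A segment between two vertices is the two-element set of its ends. *)
record quadrangulation =
  corners :: nat
  diagonals :: "nat set set"

(* The sides of the convex polygon spanned by a set S of vertices join cyclically consecutive
   elements of S: nothing of S strictly between them, or everything (Min S and Max S). *)
definition sides :: "nat set \<Rightarrow> nat set set" where
  "sides S = {{x, y} | x y. x \<in> S \<and> y \<in> S \<and> x < y \<and> (S \<inter> {x<..<y} = {} \<or> S \<subseteq> {x..y})}"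

definition crossing :: "nat set \<Rightarrow> nat set \<Rightarrow> bool" where
  "crossing d e \<longleftrightarrow>
     (\<exists>a b a' b'. a < a' \<and> a' < b \<and> b < b' \<and> {d, e} = {{a, b}, {a', b'}})"

(* The pieces into which the diagonals cut the polygon, given by their vertex sets: the
   subpolygons bounded by diagonals in Q and polygon sides that no diagonal in Q cuts further. *)
definition squares :: "quadrangulation \<Rightarrow> nat set set" where
  "squares Q = {S. S \<subseteq> {..<corners Q} \<and> 3 \<le> card S \<and>
     sides S \<subseteq> diagonals Q \<union> sides {..<corners Q} \<and>
     (\<forall>d\<in>diagonals Q. d \<subseteq> S \<longrightarrow> d \<in> sides S)}"

definition is_quadrangulation :: "quadrangulation \<Rightarrow> bool" where
  "is_quadrangulation Q \<longleftrightarrow> even (corners Q) \<and> 4 \<le> corners Q \<and>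
     (\<forall>d\<in>diagonals Q. d \<subseteq> {..<corners Q} \<and> card d = 2 \<and> d \<notin> sides {..<corners Q}) \<and>
     (\<forall>d\<in>diagonals Q. \<forall>e\<in>diagonals Q. \<not> crossing d e) \<and>
     (\<forall>S\<in>squares Q. card S = 4)"

definition adjacent :: "quadrangulation \<Rightarrow> nat set \<Rightarrow> nat set \<Rightarrow> bool" where
  "adjacent Q s t \<longleftrightarrow> s \<in> squares Q \<and> t \<in> squares Q \<and> s \<noteq> t \<and>
     (\<exists>d\<in>diagonals Q. d \<in> sides s \<and> d \<in> sides t)"

definition square_path :: "quadrangulation \<Rightarrow> nat set list \<Rightarrow> bool" where
  "square_path Q p \<longleftrightarrow> p \<noteq> [] \<and> distinct p \<and> set p \<subseteq> squares Q \<and>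
     (\<forall>i. Suc i < length p \<longrightarrow> adjacent Q (p ! i) (p ! Suc i))"

(* The sides of the square q through which the path p enters or leaves it: two sides at an
   intermediate square, one at an extremity, none off the path. *)
definition path_sides :: "nat set list \<Rightarrow> nat set \<Rightarrow> nat set set" where
  "path_sides p q = (\<Union>i\<in>{i. Suc i < length p \<and> (q = p ! i \<or> q = p ! Suc i)}.
     sides (p ! i) \<inter> sides (p ! Suc i))"

(* for two sides of the same square *)
definition opposite :: "nat set \<Rightarrow> nat set \<Rightarrow> bool" where
  "opposite e f \<longleftrightarrow> e \<inter> f = {}"

definition serpent :: "quadrangulation \<Rightarrow> nat set set \<Rightarrow> bool" where
  "serpent Q S \<longleftrightarrow> (\<exists>p. square_path Q p \<and> hd p \<noteq> last p \<and> S = {hd p, last p} \<and>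
     (\<forall>q\<in>set p. \<forall>e\<in>path_sides p q. \<forall>f\<in>path_sides p q. \<not> opposite e f))"

(* As the squares form a tree, the path p is unique up to reversal, and reversing it does not
   change path_sides. *)
definition serpent_sides :: "quadrangulation \<Rightarrow> nat set set \<Rightarrow> nat set \<Rightarrow> nat set set" where
  "serpent_sides Q S q = (\<Union>p\<in>{p. square_path Q p \<and> S = {hd p, last p}}. path_sides p q)"

(* The two extremities of one serpent lie in different squares, so only distinct serpents
   have to be compared. *)
definition compatible_sets :: "quadrangulation \<Rightarrow> nat set set set set" where
  "compatible_sets Q = {A. A \<subseteq> {S. serpent Q S} \<and>
     (\<forall>S\<in>A. \<forall>T\<in>A. S \<noteq> T \<longrightarrow>
        (\<forall>q\<in>S \<inter> T. serpent_sides Q S q \<inter> serpent_sides Q T q = {}))}"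

(* the number of path segments in q from the side e to the centre *)
definition stops :: "quadrangulation \<Rightarrow> nat set set set \<Rightarrow> nat set \<Rightarrow> nat set \<Rightarrow> nat" where
  "stops Q A q e = card {S\<in>A. q \<in> S \<and> e \<in> serpent_sides Q S q}"

(* the number of path segments in q from the side e to the side f *)
definition turns ::
    "quadrangulation \<Rightarrow> nat set set set \<Rightarrow> nat set \<Rightarrow> nat set \<Rightarrow> nat set \<Rightarrow> nat" where
  "turns Q A q e f = card {S\<in>A. e \<in> serpent_sides Q S q \<and> f \<in> serpent_sides Q S q}"

definition same_pattern :: "quadrangulation \<Rightarrow> (nat set set set \<times> nat set set set) set" where
  "same_pattern Q = {(A, B). A \<in> compatible_sets Q \<and> B \<in> compatible_sets Q \<and>
     (\<forall>q\<in>squares Q.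
        (\<forall>e\<in>sides q. stops Q A q e = stops Q B q e) \<and>
        (\<forall>e\<in>sides q. \<forall>f\<in>sides q. e \<noteq> f \<and> \<not> opposite e f \<longrightarrow>
           turns Q A q e f = turns Q B q e f))}"

definition serpent_nests :: "quadrangulation \<Rightarrow> nat set set set set set" where
  "serpent_nests Q = compatible_sets Q // same_pattern Q"

(* All members of a class have the same cardinality, half the total number of stops. *)
definition rk :: "nat set set set set \<Rightarrow> nat" where
  "rk \<sigma> = the_elem (card ` \<sigma>)"

definition h_vector :: "quadrangulation \<Rightarrow> int poly" where
  "h_vector Q = (\<Sum>\<sigma>\<in>serpent_nests Q. monom 1 (rk \<sigma>))"

(* The i-th square of the string (0 \<le> i \<le> n) has the lower vertices B i, B (i + 1) and the upper
   vertices T i, T (i + 1), where B and T are bottom_corner n and top_corner n. Along the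
   polygon come first the vertices at the bottom from left to right, with the two remaining
   corners of an extra square between B i and B (i + 1) for 0 < i < n, and then
   T (n + 1), ..., T 0. Truncated subtraction gives B 0 = 0. *)
definition bottom_corner :: "nat \<Rightarrow> nat \<Rightarrow> nat" where
  "bottom_corner n i = (if i \<le> n then 3 * i - 2 else 3 * n - 1)"

definition top_corner :: "nat \<Rightarrow> nat \<Rightarrow> nat" where
  "top_corner n i = 4 * n + 1 - i"

(* intended for n \<ge> 1 *)
definition L :: "nat \<Rightarrow> quadrangulation" where
  "L n = \<lparr>corners = 4 * n + 2,
     diagonals = {{bottom_corner n i, top_corner n i} | i. 1 \<le> i \<and> i \<le> n} \<union>
       {{bottom_corner n i, bottom_corner n (i + 1)} | i. 1 \<le> i \<and> i < n}\<rparr>"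

definition lucas_h :: "nat \<Rightarrow> int poly" where
  "lucas_h n = (if n = 0 then 0 else h_vector (L n))"

(* The rest checks the encoding: L n is a quadrangulation and its squares are the ones
   described at bottom_corner. *)

lemma sides_iff:
  assumes "x < y"
  shows "{x, y} \<in> sides S \<longleftrightarrow> x \<in> S \<and> y \<in> S \<and> (S \<inter> {x<..<y} = {} \<or> S \<subseteq> {x..y})"
  using assms unfolding sides_def by (fastforce simp: doubleton_eq_iff)

lemma sides_quadruple:
  assumes "a < b" "b < c" "c < d"
  shows "sides {a, b, c, d} = {{a, b}, {b, c}, {c, d}, {a, d}}"
proof (intro equalityI subsetI)
  fix e assume "e \<in> sides {a, b, c, d}"
  then obtain x y where e: "e = {x, y}" and xy: "x \<in> {a, b, c, d}" "y \<in> {a, b, c, d}" "x < y"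
    "{a, b, c, d} \<inter> {x<..<y} = {} \<or> {a, b, c, d} \<subseteq> {x..y}"
    unfolding sides_def mem_Collect_eq by (elim exE conjE) (rule that)
  from xy(4) have "\<not> (x = a \<and> y = c) \<and> \<not> (x = b \<and> y = d)" using assms by auto
  then have "x = a \<and> y = b \<or> x = b \<and> y = c \<or> x = c \<and> y = d \<or> x = a \<and> y = d"
    using xy(1-3) assms by (elim insertE emptyE) simp_all
  then show "e \<in> {{a, b}, {b, c}, {c, d}, {a, d}}"
    unfolding e by (elim disjE conjE) simp_all
next
  fix e assume "e \<in> {{a, b}, {b, c}, {c, d}, {a, d}}"
  then show "e \<in> sides {a, b, c, d}"
    using assms by (elim insertE emptyE) (simp_all add: sides_iff)
qed

lemma sides_polygon_iff:
  assumes "x < y"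
  shows "{x, y} \<in> sides {..<N} \<longleftrightarrow> y < N \<and> (y = Suc x \<or> x = 0 \<and> Suc y = N)"
proof -
  have "{..<N} \<inter> {x<..<y} = {} \<longleftrightarrow> y = Suc x" if "y < N"
  proof
    assume "{..<N} \<inter> {x<..<y} = {}"
    then have "Suc x \<notin> {..<N} \<inter> {x<..<y}" by blast
    then show "y = Suc x" using that assms by auto
  qed auto
  moreover have "{..<N} \<subseteq> {x..y} \<longleftrightarrow> x = 0 \<and> Suc y = N" if "y < N"
  proof
    assume sub: "{..<N} \<subseteq> {x..y}"
    have "0 \<in> {x..y}" by (rule subsetD[OF sub]) (use that in simp)
    moreover have "N - 1 \<in> {x..y}" by (rule subsetD[OF sub]) (use that in simp)
    ultimately show "x = 0 \<and> Suc y = N" using that by auto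
  qed auto
  ultimately show ?thesis unfolding sides_iff[OF assms] using assms by auto
qed

lemma diagonals_L_iff:
  assumes "x < y"
  shows "{x, y} \<in> diagonals (L n) \<longleftrightarrow>
    (\<exists>i. 1 \<le> i \<and> i \<le> n \<and> x = 3 * i - 2 \<and> y = 4 * n + 1 - i) \<or>
    (\<exists>i. 1 \<le> i \<and> i < n \<and> x = 3 * i - 2 \<and> y = 3 * i + 1)"
proof -
  have 1: "{x, y} = {bottom_corner n i, top_corner n i} \<longleftrightarrow> x = 3 * i - 2 \<and> y = 4 * n + 1 - i"
    if "1 \<le> i" "i \<le> n" for i
    using that assms by (auto simp: doubleton_eq_iff bottom_corner_def top_corner_def)
  have 2: "{x, y} = {bottom_corner n i, bottom_corner n (i+1)} \<longleftrightarrow> x = 3 * i - 2 \<and> y = 3 * i + 1"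
    if "1 \<le> i" "i < n" for i
    using that assms by (auto simp: doubleton_eq_iff bottom_corner_def)
  have "{x, y} \<in> diagonals (L n) \<longleftrightarrow>
    (\<exists>i. 1 \<le> i \<and> i \<le> n \<and> {x, y} = {bottom_corner n i, top_corner n i}) \<or>
    (\<exists>i. 1 \<le> i \<and> i < n \<and> {x, y} = {bottom_corner n i, bottom_corner n (i+1)})"
    by (simp only: L_def quadrangulation.simps Un_iff mem_Collect_eq) blast
  then show ?thesis using 1 2 by metis
qed

lemma diagonals_L_E:
  assumes "d \<in> diagonals (L n)"
  obtains x y where "d = {x, y}" "x < y"
proof -
  consider i where "1 \<le> i" "i \<le> n" "d = {bottom_corner n i, top_corner n i}"
    | i where "1 \<le> i" "i < n" "d = {bottom_corner n i, bottom_corner n (i + 1)}"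
    using assms by (auto simp: L_def)
  then show thesis
  proof cases
    case 1 then show thesis by (intro that[OF 1(3)]) (auto simp: bottom_corner_def top_corner_def)
  next
    case 2 then show thesis by (intro that[OF 2(3)]) (auto simp: bottom_corner_def)
  qed
qed

lemma next_side:
  assumes "finite S" "x \<in> S" "z \<in> S" "x < z"
  obtains y where "y \<in> S" "x < y" "y \<le> z" "{x, y} \<in> sides S"
proof -
  let ?y = "Min {y\<in>S. x < y}"
  have y: "?y \<in> {y\<in>S. x < y}" by (rule Min_in) (use assms in auto)
  have le: "?y \<le> w" if "w \<in> S" "x < w" for w by (rule Min_le) (use assms that in auto)
  have "S \<inter> {x<..<?y} = {}" using le by fastforce
  then have "{x, ?y} \<in> sides S" using y assms by (subst sides_iff) auto
  then show thesis using that[of ?y] y le assms by auto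
qed

lemma prev_side:
  assumes "finite S" "x \<in> S" "z \<in> S" "z < x"
  obtains y where "y \<in> S" "y < x" "z \<le> y" "{y, x} \<in> sides S"
proof -
  let ?y = "Max {y\<in>S. y < x}"
  have y: "?y \<in> {y\<in>S. y < x}" by (rule Max_in) (use assms in auto)
  have le: "w \<le> ?y" if "w \<in> S" "w < x" for w by (rule Max_ge) (use assms that in auto)
  have "S \<inter> {?y<..<x} = {}" using le by fastforce
  then have "{?y, x} \<in> sides S" using y assms by (subst sides_iff) auto
  then show thesis using that[of ?y] y le assms by auto
qed

lemma squares_L_subset:
  assumes n: "1 \<le> n" and S: "S \<in> squares (L n)"
  shows "(\<exists>i\<le>n. S = {bottom_corner n i, bottom_corner n (i + 1), top_corner n (i + 1), top_corner n i}) \<or>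
    (\<exists>i. 1 \<le> i \<and> i < n \<and> S = {3 * i - 2, 3 * i - 1, 3 * i, 3 * i + 1})"
proof -
  have sub: "S \<subseteq> {..<4*n+2}" and card: "3 \<le> card S"
    and sd: "sides S \<subseteq> diagonals (L n) \<union> sides {..<4*n+2}"
    and di: "\<And>d. d\<in>diagonals (L n) \<Longrightarrow> d \<subseteq> S \<Longrightarrow> d \<in> sides S"
    using S by (auto simp: squares_def L_def)
  have fin: "finite S" using sub finite_subset by blast
  have ne: "S \<noteq> {}" using card by auto
  define m M where "m = Min S" and "M = Max S"
  have mM: "m \<in> S" "M \<in> S" "\<And>x. x \<in> S \<Longrightarrow> m \<le> x \<and> x \<le> M"
    using fin ne by (auto simp: m_def M_def)
  have "\<not> S \<subseteq> {m, M}" using card card_mono[of "{m,M}" S] card_insert_le_m1[of 2 "{M}" m] by auto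
  then obtain w where w: "w \<in> S" "w \<noteq> m" "w \<noteq> M" by blast
  then have mw: "m < w" "w < M" using mM(3)[OF w(1)] by auto
  have edge: "(y = Suc x \<or> x = 0 \<and> y = 4 * n + 1) \<or>
    (\<exists>i. 1 \<le> i \<and> i \<le> n \<and> x = 3 * i - 2 \<and> y = 4 * n + 1 - i) \<or>
    (\<exists>i. 1 \<le> i \<and> i < n \<and> x = 3 * i - 2 \<and> y = 3 * i + 1)"
    if "{x, y} \<in> sides S" "x < y" for x y
  proof -
    have "{x,y} \<in> diagonals (L n) \<or> {x,y} \<in> sides {..<4*n+2}" using that sd by blast
    then show ?thesis unfolding diagonals_L_iff[OF that(2)] sides_polygon_iff[OF that(2)] by auto
  qed
  have bt: "{3 * i - 2, 4 * n + 1 - i} \<in> sides S"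
    if "1 \<le> i" "i \<le> n" "3 * i - 2 \<in> S" "4 * n + 1 - i \<in> S" for i
    by (rule di, subst diagonals_L_iff) (use that in auto)
  have bb: "{3 * i - 2, 3 * i + 1} \<in> sides S"
    if "1 \<le> i" "i < n" "3 * i - 2 \<in> S" "3 * i + 1 \<in> S" for i
    by (rule di, subst diagonals_L_iff) (use that in auto)
  obtain y where y: "y \<in> S" "m < y" "y \<le> w" "{m, y} \<in> sides S"
    using next_side[OF fin mM(1) w(1) mw(1)] by blast
  obtain z where z: "z \<in> S" "z < M" "w \<le> z" "{z, M} \<in> sides S"
    using prev_side[OF fin mM(2) w(1) mw(2)] by blast
  have my: "S \<inter> {m<..<y} = {}" using y(4)[unfolded sides_iff[OF y(2)]] y mw mM(2) by auto
  have zM: "S \<inter> {z<..<M} = {}" using z(4)[unfolded sides_iff[OF z(2)]] z mw mM(1) by auto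
  have quad: "S = {m, y, z, M}" if "S \<inter> {y<..<z} = {}"
  proof
    show "S \<subseteq> {m,y,z,M}"
    proof
      fix x assume x: "x \<in> S"
      then have "x \<notin> {m<..<y}" "x \<notin> {y<..<z}" "x \<notin> {z<..<M}" "m \<le> x" "x \<le> M"
        using my zM that mM(3) by blast+
      then show "x \<in> {m,y,z,M}" by auto
    qed
  qed (use y z mM in auto)
  have "{m, M} \<in> sides S" by (subst sides_iff) (use mM mw in auto)
  from edge[OF this] mw consider (a) "m = 0" "M = 4 * n + 1"
    | (b) i where "1 \<le> i" "i \<le> n" "m = 3 * i - 2" "M = 4 * n + 1 - i"
    | (c) i where "1 \<le> i" "i < n" "m = 3 * i - 2" "M = 3 * i + 1" by auto
  then show ?thesis
  proof cases
    case a
    have y1: "y = 1" using edge[OF y(4) y(2)] a y mw by auto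
    have z1: "z = 4 * n" using edge[OF z(4) z(2)] a z mw by auto
    have "{1, 4 * n} \<in> sides S" using bt[of 1] n y z y1 z1 by auto
    then have "S \<inter> {1<..<4*n} = {}" using sides_iff[of 1 "4*n" S] n mM(1) a by auto
    then have "S = {m,y,z,M}" using quad y1 z1 by auto
    then show ?thesis using a y1 z1 n
      by (intro disjI1 exI[of _ 0]) (auto simp: bottom_corner_def top_corner_def)
  next
    case b
    have z1: "z = 4 * n - i" using edge[OF z(4) z(2)] b z mw by auto
    have y1: "y = 3 * i - 1 \<or> i < n \<and> y = 3 * i + 1" using edge[OF y(4) y(2)] b y mw by auto
    show ?thesis
    proof (cases "i = n")
      case True
      then have yz: "y = 3 * n - 1" "z = 3 * n" using y1 z1 by auto
      then have "S = {m,y,z,M}" by (intro quad) auto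
      then show ?thesis using b True yz
        by (intro disjI1 exI[of _ n]) (auto simp: bottom_corner_def top_corner_def)
    next
      case False
      with b have i: "i < n" by auto
      have "y \<noteq> 3 * i - 1"
      proof
        assume y2: "y = 3 * i - 1"
        have mod3: "3 * i - 1 \<noteq> 3 * j - 2" "3 * i \<noteq> 3 * j - 2" if "1 \<le> j" for j
          using that b(1) by presburger+
        have "y < M" using y mw by auto
        then obtain u where u: "u \<in> S" "y < u" "{y, u} \<in> sides S"
          using next_side[OF fin y(1) mM(2)] by blast
        have u1: "u = 3 * i" using edge[OF u(3,2)]
        proof (elim disjE exE conjE)
          fix j assume "1 \<le> j" "y = 3 * j - 2"
          then show ?thesis using y2 b(1) mod3(1)[of j] by simp
        next
          fix j assume "1 \<le> j" "y = 3 * j - 2"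
          then show ?thesis using y2 b(1) mod3(1)[of j] by simp
        qed (use y2 b(1) in auto)
        have "u < M" using u1 b i by auto
        then obtain v where v: "v \<in> S" "u < v" "{u, v} \<in> sides S"
          using next_side[OF fin u(1) mM(2)] by blast
        have v1: "v = 3 * i + 1" using edge[OF v(3,2)]
        proof (elim disjE exE conjE)
          fix j assume "1 \<le> j" "u = 3 * j - 2"
          then show ?thesis using u1 b(1) mod3(2)[of j] by simp
        next
          fix j assume "1 \<le> j" "u = 3 * j - 2"
          then show ?thesis using u1 b(1) mod3(2)[of j] by simp
        qed (use u1 b(1) in auto)
        have "{3 * i - 2, 3 * i + 1} \<in> sides S" using bb[of i] b i v v1 mM by auto
        then have "S \<inter> {3*i-2<..<3*i+1} = {} \<or> S \<subseteq> {3*i-2..3*i+1}" using b by (subst (asm) sides_iff) auto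
        moreover have "y \<in> S \<inter> {3*i-2<..<3*i+1}" using y y2 b by auto
        moreover have "M \<notin> {3*i-2..3*i+1}" using b i by auto
        ultimately show False using mM(2) by blast
      qed
      then have y2: "y = 3 * i + 1" using y1 by auto
      have "{3 * i + 1, 4 * n - i} \<in> sides S" using bt[of "Suc i"] i b y z y2 z1 by auto
      then have "S \<inter> {3*i+1<..<4*n-i} = {} \<or> S \<subseteq> {3*i+1..4*n-i}"
        using b i by (subst (asm) sides_iff) auto
      moreover have "m \<notin> {3*i+1..4*n-i}" using b by auto
      ultimately have "S \<inter> {y<..<z} = {}" using y2 z1 mM(1) by blast
      then have "S = {m,y,z,M}" by (rule quad)
      then show ?thesis using b y2 z1 i
        by (intro disjI1 exI[of _ i]) (auto simp: bottom_corner_def top_corner_def)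
    qed
  next
    case c
    have "Suc (3 * i - 2) = 3 * i - 1" using c(1) by arith
    then have y1: "y = 3 * i - 1" using edge[OF y(4) y(2)] c y mw by auto
    have z1: "z = 3 * i" using edge[OF z(4) z(2)] c z mw by auto
    have "S = {m,y,z,M}" by (rule quad) (use y1 z1 in auto)
    then show ?thesis using c y1 z1 by (intro disjI2 exI[of _ i]) auto
  qed
qed

lemma quadruple_square:
  assumes "a < b" "b < c" "c < d" "d < corners Q"
    "{{a, b}, {b, c}, {c, d}, {a, d}} \<subseteq> diagonals Q \<union> sides {..<corners Q}"
    "{a, c} \<notin> diagonals Q" "{b, d} \<notin> diagonals Q" "\<And>e. e \<in> diagonals Q \<Longrightarrow> \<exists>x y. e = {x, y} \<and> x < y"
  shows "{a, b, c, d} \<in> squares Q"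
proof -
  have "e \<in> sides {a,b,c,d}" if "e \<in> diagonals Q" "e \<subseteq> {a,b,c,d}" for e
  proof -
    obtain x y where e: "e = {x,y}" "x < y" using assms(8) \<open>e \<in> diagonals Q\<close> by blast
    then have "x \<in> {a,b,c,d}" "y \<in> {a,b,c,d}" "\<not> (x = a \<and> y = c)" "\<not> (x = b \<and> y = d)"
      using that assms by auto
    then have "x = a \<and> y = b \<or> x = b \<and> y = c \<or> x = c \<and> y = d \<or> x = a \<and> y = d"
      using e(2) assms(1-3) by (elim insertE emptyE) (simp_all del: One_nat_def)
    then have "e \<in> {{a, b}, {b, c}, {c, d}, {a, d}}" using e(1) by blast
    then show ?thesis unfolding sides_quadruple[OF assms(1-3)] .
  qed
  moreover have "{a, b, c, d} \<subseteq> {..<corners Q}" using assms(1-4) by simp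
  moreover have "3 \<le> card {a, b, c, d}" using assms(1-3) by simp
  moreover have "sides {a, b, c, d} \<subseteq> diagonals Q \<union> sides {..<corners Q}"
    unfolding sides_quadruple[OF assms(1-3)] by (rule assms(5))
  ultimately show ?thesis unfolding squares_def mem_Collect_eq by (intro conjI ballI impI)
qed

lemma squares_L:
  assumes n: "1 \<le> n"
  shows "squares (L n) =
    {{bottom_corner n i, bottom_corner n (i + 1), top_corner n (i + 1), top_corner n i} | i. i \<le> n} \<union>
    {{3 * i - 2, 3 * i - 1, 3 * i, 3 * i + 1} | i. 1 \<le> i \<and> i < n}" (is "_ = ?A \<union> ?B")
proof
  show "squares (L n) \<subseteq> ?A \<union> ?B"
  proof
    fix S assume "S \<in> squares (L n)"
    from squares_L_subset[OF n this] show "S \<in> ?A \<union> ?B"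
    proof (elim disjE exE conjE)
      fix i assume "i \<le> n" "S = {bottom_corner n i, bottom_corner n (i + 1), top_corner n (i + 1), top_corner n i}"
      then show ?thesis by (intro UnI1 CollectI exI conjI)
    next
      fix i assume "1 \<le> i" "i < n" "S = {3 * i - 2, 3 * i - 1, 3 * i, 3 * i + 1}"
      then show ?thesis by (intro UnI2 CollectI exI conjI)
    qed
  qed
  have cor: "corners (L n) = 4 * n + 2" by (simp add: L_def)
  have E: "\<And>e. e \<in> diagonals (L n) \<Longrightarrow> \<exists>x y. e = {x, y} \<and> x < y" using diagonals_L_E by metis
  let ?E = "diagonals (L n) \<union> sides {..<corners (L n)}"
  have quad: "{a, b, c, d} \<in> squares (L n)"
    if "a < b" "b < c" "c < d" "d < 4 * n + 2"
      and "{a, b} \<in> ?E" "{b, c} \<in> ?E" "{c, d} \<in> ?E" "{a, d} \<in> ?E"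
      and "\<And>i. 1 \<le> i \<Longrightarrow> i \<le> n \<Longrightarrow> a = 3 * i - 2 \<Longrightarrow> c \<noteq> 4 * n + 1 - i"
      and "\<And>i. 1 \<le> i \<Longrightarrow> i < n \<Longrightarrow> a = 3 * i - 2 \<Longrightarrow> c \<noteq> 3 * i + 1"
      and "\<And>i. 1 \<le> i \<Longrightarrow> i \<le> n \<Longrightarrow> b = 3 * i - 2 \<Longrightarrow> d \<noteq> 4 * n + 1 - i"
      and "\<And>i. 1 \<le> i \<Longrightarrow> i < n \<Longrightarrow> b = 3 * i - 2 \<Longrightarrow> d \<noteq> 3 * i + 1"
    for a b c d
  proof (rule quadruple_square)
    have "a < c" "b < d" using that(1-3) by auto
    show "{a, c} \<notin> diagonals (L n)"
      unfolding diagonals_L_iff[OF \<open>a < c\<close>] using that(9,10) by blast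
    show "{b, d} \<notin> diagonals (L n)"
      unfolding diagonals_L_iff[OF \<open>b < d\<close>] using that(11,12) by blast
  qed (use that(1-8) E cor in simp_all)
  have ps: "{x, y} \<in> diagonals (L n) \<union> sides {..<corners (L n)}"
    if "x < y" "y < 4 * n + 2" "y = Suc x \<or> x = 0 \<and> y = 4 * n + 1" for x y
    using that by (auto simp: sides_polygon_iff cor)
  have bt: "{3 * i - 2, 4 * n + 1 - i} \<in> diagonals (L n) \<union> sides {..<corners (L n)}"
    if "1 \<le> i" "i \<le> n" for i by (rule UnI1, subst diagonals_L_iff) (use that in auto)
  have bb: "{3 * i - 2, 3 * i + 1} \<in> diagonals (L n) \<union> sides {..<corners (L n)}"
    if "1 \<le> i" "i < n" for i by (rule UnI1, subst diagonals_L_iff) (use that in auto)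
  have "{bottom_corner n i, bottom_corner n (i + 1), top_corner n (i + 1), top_corner n i} \<in> squares (L n)"
    (is "?s \<in> _") if i: "i \<le> n" for i
  proof -
    consider "i = 0" | "1 \<le> i" "i < n" | "i = n" "1 \<le> i" using i n by linarith
    then show ?thesis
    proof cases
      case 1
      have s: "?s = {0, 1, 4 * n, 4 * n + 1}"
        using 1 n n by (auto simp: bottom_corner_def top_corner_def)
      have e0: "{0, 1} \<in> ?E" by (rule ps) (use 1 n in arith)+
      have e1: "{1, 4 * n} \<in> ?E" using bt[of 1] 1 n by simp
      have e2: "{4 * n, 4 * n + 1} \<in> ?E" by (rule ps) (use 1 n in arith)+
      have e3: "{0, 4 * n + 1} \<in> ?E" by (rule ps) (use 1 n in arith)+
      show ?thesis unfolding s
        by (rule quad[OF _ _ _ _ e0 e1 e2 e3]) (use 1 n in arith)+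
    next
      case 2
      have s: "?s = {3 * i - 2, 3 * i + 1, 4 * n - i, 4 * n + 1 - i}"
        using 2 n by (auto simp: bottom_corner_def top_corner_def)
      have e0: "{3 * i - 2, 3 * i + 1} \<in> ?E" using bb[of i] 2 by simp
      have e1: "{3 * i + 1, 4 * n - i} \<in> ?E" using bt[of "i + 1"] 2 by simp
      have e2: "{4 * n - i, 4 * n + 1 - i} \<in> ?E" by (rule ps) (use 2 in arith)+
      have e3: "{3 * i - 2, 4 * n + 1 - i} \<in> ?E" using bt[of i] 2 by simp
      show ?thesis unfolding s
        by (rule quad[OF _ _ _ _ e0 e1 e2 e3]) (use 2 in arith)+
    next
      case 3
      have s: "?s = {3 * n - 2, 3 * n - 1, 3 * n, 3 * n + 1}"
        using 3 n n by (auto simp: bottom_corner_def top_corner_def)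
      have e0: "{3 * n - 2, 3 * n - 1} \<in> ?E" by (rule ps) (use 3 n in arith)+
      have e1: "{3 * n - 1, 3 * n} \<in> ?E" by (rule ps) (use 3 n in arith)+
      have e2: "{3 * n, 3 * n + 1} \<in> ?E" by (rule ps) (use 3 n in arith)+
      have e3: "{3 * n - 2, 3 * n + 1} \<in> ?E" using bt[of n] 3 n by simp
      show ?thesis unfolding s
        by (rule quad[OF _ _ _ _ e0 e1 e2 e3]) (use 3 n in arith)+
    qed
  qed
  moreover have "{3 * i - 2, 3 * i - 1, 3 * i, 3 * i + 1} \<in> squares (L n)" if i: "1 \<le> i" "i < n" for i
  proof -
    have e0: "{3 * i - 2, 3 * i - 1} \<in> ?E" by (rule ps) (use i in arith)+
    have e1: "{3 * i - 1, 3 * i} \<in> ?E" by (rule ps) (use i in arith)+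
    have e2: "{3 * i, 3 * i + 1} \<in> ?E" by (rule ps) (use i in arith)+
    have e3: "{3 * i - 2, 3 * i + 1} \<in> ?E" using bb[of i] i by simp
    show ?thesis
      by (rule quad[OF _ _ _ _ e0 e1 e2 e3]) (use i in arith)+
  qed
  ultimately show "?A \<union> ?B \<subseteq> squares (L n)"
    by (intro Un_least subsetI; elim CollectE exE conjE) (simp_all only:)
qed

lemma is_quadrangulation_L:
  assumes n: "1 \<le> n"
  shows "is_quadrangulation (L n)"
proof -
  have cor: "corners (L n) = 4 * n + 2" by (simp add: L_def)
  have 1: "d \<subseteq> {..<4*n+2} \<and> card d = 2 \<and> d \<notin> sides {..<4*n+2}" if "d \<in> diagonals (L n)" for d
  proof -
    obtain x y where d: "d = {x,y}" "x < y" using diagonals_L_E \<open>d \<in> diagonals (L n)\<close> by metis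
    have "y < 4*n+2 \<and> 0 < x \<and> Suc x < y" using that unfolding d(1) diagonals_L_iff[OF d(2)] by auto
    then show ?thesis unfolding d(1) sides_polygon_iff[OF d(2)] using d(2) by auto
  qed
  have 2: False if d: "{a,b} \<in> diagonals (L n)" "{a',b'} \<in> diagonals (L n)" and l: "a < a'" "a' < b" "b < b'" for a b a' b'
  proof -
    have "a < b" "a' < b'" using l by auto
    moreover have aux: "\<not> 3 * j - 2 < Suc (3 * i)" if "3 * i - 2 < 3 * j - 2" for i j :: nat
      using that by presburger
    ultimately show False using d l by (auto simp: diagonals_L_iff dest: aux)
  qed
  have 2: "\<not> crossing d e" if "d \<in> diagonals (L n)" "e \<in> diagonals (L n)" for d e
  proof
    assume "crossing d e"
    then obtain a b a' b' where l: "a < a'" "a' < b" "b < b'" "{d, e} = {{a, b}, {a', b'}}"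
      by (auto simp: crossing_def)
    have "{a, b} \<in> {d, e}" "{a', b'} \<in> {d, e}" unfolding l(4) by simp_all
    then have "{a, b} \<in> diagonals (L n)" "{a', b'} \<in> diagonals (L n)" using that by auto
    then show False using 2 l(1-3) by metis
  qed
  have "card S = 4" if "S \<in> squares (L n)" for S
    using that unfolding squares_L[OF n] using n
    by (auto simp: bottom_corner_def top_corner_def card_insert_if)
  then show ?thesis unfolding is_quadrangulation_def cor using 1 2 n by auto
qed

end

theory Submission
  imports Defs
begin

text \<open>Number the squares of \<^term>\<open>L n\<close> by a column \<open>i \<le> n\<close> and a Boolean that tells the extra square
below column \<open>i\<close> (\<open>0 < i < n\<close>) from the square of the string. Two squares have at most one common
side: a \<^emph>\<open>gate\<close> between consecutive columns, or a \<^emph>\<open>hatch\<close> between the two squares of a column.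

A path without repetitions passes a gate or a hatch exactly when this separates its ends
(\<open>path_cut_iff\<close>), so the sides used by a serpent depend only on its extremities. A serpent may not go
straight through a square of the string, hence it passes at most one gate (\<open>serpent_L_iff\<close>). Thus there
are only \<^emph>\<open>links\<close>, from a square of column \<open>i\<close> to a square of column \<open>i + 1\<close>, and \<^emph>\<open>stubs\<close>, joining the
two squares of a column. A set of serpents is compatible iff the links through each gate form a
partial matching between the (at most two) squares on its left and those on its right, and each extra
square is an extremity of at most one serpent (\<open>compatible_L_iff\<close>).

The pattern of paths remembers which squares on the left and on the right of each gate are matched
and where the stubs are, but not how the matching pairs them (\<open>same_pattern_L_iff\<close>). So a nest is a word
with one letter per gate. Reading a word from left to right, the only information needed about the past
is whether the extra square between two consecutive gates is already taken from the left. Hence the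
words are counted by a product of \<open>2 \<times> 2\<close> matrices: if \<open>f\<^sub>n\<close> and \<open>t\<^sub>n\<close> are the sums of
\<open>x\<close> to the rank over the words of length \<open>n\<close> whose first extra square is free and taken,
respectively, then
\<open>f\<^sub>n\<^sub>+\<^sub>1 = (1 + 3x + x\<^sup>2) f\<^sub>n + (2x + 2x\<^sup>2) t\<^sub>n\<close> and
\<open>t\<^sub>n\<^sub>+\<^sub>1 = (1 + x) f\<^sub>n + x t\<^sub>n\<close> (\<open>word_poly_transfer\<close>). Column \<open>0\<close> has no extra
square, which has the same effect as an extra square that is taken, so \<open>\<ell>\<^sub>n = t\<^sub>n\<close>, with \<open>t\<^sub>0
    = 0\<close> in
accordance with \<open>\<ell>\<^sub>0 = 0\<close>. The matrix has the trace \<open>1 + 4x + x\<^sup>2\<close> and the determinant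
\<open>- x (1 + x + x\<^sup>2)\<close>, and the recurrence is its characteristic equation.\<close>

section \<open>Squares and their common sides\<close>

definition site :: "nat \<Rightarrow> nat \<Rightarrow> bool \<Rightarrow> bool" where
  "site n i b \<longleftrightarrow> i \<le> n \<and> (b \<longrightarrow> 0 < i \<and> i < n)"

definition square :: "nat \<Rightarrow> nat \<Rightarrow> bool \<Rightarrow> nat set" where
  "square n i b = (if b then {3 * i - 2, 3 * i - 1, 3 * i, 3 * i + 1}
     else {bottom_corner n i, bottom_corner n (i + 1), top_corner n (i + 1), top_corner n i})"

definition gate :: "nat \<Rightarrow> nat \<Rightarrow> nat set" where
  "gate n i = {bottom_corner n (Suc i), top_corner n (Suc i)}"

definition hatch :: "nat \<Rightarrow> nat \<Rightarrow> nat set" where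
  "hatch n i = {bottom_corner n i, bottom_corner n (Suc i)}"

lemma squares_L_sites:
  assumes "1 \<le> n"
  shows "squares (L n) = {square n i b | i b. site n i b}"
proof -
  have "{square n i b | i b. site n i b} =
      {square n i False | i. i \<le> n} \<union> {square n i True | i. 1 \<le> i \<and> i < n}"
  proof (intro equalityI subsetI)
    fix q assume "q \<in> {square n i b | i b. site n i b}"
    then obtain i b where "q = square n i b" "site n i b" by blast
    then show "q \<in> {square n i False | i. i \<le> n} \<union> {square n i True | i. 1 \<le> i \<and> i < n}"
      by (cases b) (auto simp: site_def)
  next
    fix q assume "q \<in> {square n i False | i. i \<le> n} \<union> {square n i True | i. 1 \<le> i \<and> i < n}"
    then obtain i b where "q = square n i b" "site n i b" by (force simp: site_def)
    then show "q \<in> {square n i b | i b. site n i b}" by blast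
  qed
  then show ?thesis unfolding squares_L[OF assms] by (simp add: square_def)
qed

lemma corner_eq_iff:
  assumes "1 \<le> n" "i \<le> Suc n" "j \<le> Suc n"
  shows "bottom_corner n i = bottom_corner n j \<longleftrightarrow> i = j"
    and "top_corner n i = top_corner n j \<longleftrightarrow> i = j"
    and "bottom_corner n i \<noteq> top_corner n j"
proof -
  show "bottom_corner n i = bottom_corner n j \<longleftrightarrow> i = j"
    using assms by (auto simp: bottom_corner_def split: if_splits; presburger)
  show "top_corner n i = top_corner n j \<longleftrightarrow> i = j"
    using assms by (auto simp: top_corner_def)
  show "bottom_corner n i \<noteq> top_corner n j"
    using assms by (auto simp: bottom_corner_def top_corner_def)
qed

lemma bottom_in_square:
  assumes "1 \<le> n" "site n j b" "i \<le> Suc n"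
  shows "bottom_corner n i \<in> square n j b \<longleftrightarrow> i = j \<or> i = Suc j"
proof (cases b)
  case True
  then show ?thesis using assms by (auto simp: bottom_corner_def square_def site_def; presburger)
next
  case False
  then show ?thesis using assms
    by (auto simp: square_def site_def corner_eq_iff)
qed

lemma top_in_square:
  assumes "1 \<le> n" "site n j b" "i \<le> Suc n"
  shows "top_corner n i \<in> square n j b \<longleftrightarrow> \<not> b \<and> (i = j \<or> i = Suc j)"
proof (cases b)
  case True
  then show ?thesis using assms by (auto simp: top_corner_def square_def site_def)
next
  case False
  then show ?thesis using assms
    by (auto simp: square_def site_def corner_eq_iff corner_eq_iff(3)[symmetric])
qed

lemma square_eq_iff:
  assumes "1 \<le> n" "site n i a" "site n j b"
  shows "square n i a = square n j b \<longleftrightarrow> i = j \<and> a = b"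
proof
  assume eq: "square n i a = square n j b"
  have le: "i \<le> Suc n" "Suc i \<le> Suc n" using assms(2) by (auto simp: site_def)
  have "i = j \<or> i = Suc j"
    using bottom_in_square[OF assms(1,2) le(1)] bottom_in_square[OF assms(1,3) le(1)] eq by simp
  moreover have "Suc i = j \<or> Suc i = Suc j"
    using bottom_in_square[OF assms(1,2) le(2)] bottom_in_square[OF assms(1,3) le(2)] eq by simp
  ultimately have "i = j" by linarith
  moreover have "a = b"
    using top_in_square[OF assms(1,2) le(1)] top_in_square[OF assms(1,3) le(1)] eq \<open>i = j\<close>
    by (cases a; cases b) simp_all
  ultimately show "i = j \<and> a = b" ..
qed simp

text \<open>The vertices are all on one square except the bottom and top corners of the string, and a corner with
index \<open>k\<close> lies on the columns \<open>k - 1\<close> and \<open>k\<close> only.\<close>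

lemma square_inter:
  assumes n: "1 \<le> n" and s: "site n i a" "site n j b" and ne: "(i, a) \<noteq> (j, b)"
    and x: "x \<in> square n i a" "x \<in> square n j b"
  shows "\<exists>k. (k = i \<or> k = Suc i) \<and> (k = j \<or> k = Suc j) \<and>
    (x = bottom_corner n k \<or> \<not> a \<and> \<not> b \<and> x = top_corner n k)"
proof -
  have corner: ?thesis if "x = bottom_corner n k \<or> x = top_corner n k" "k \<le> Suc n" for k
    using that bottom_in_square[OF n s(1) that(2)] bottom_in_square[OF n s(2) that(2)]
      top_in_square[OF n s(1) that(2)] top_in_square[OF n s(2) that(2)] x by auto
  have string: ?thesis if "site n l False" "x \<in> square n l False" for l
  proof -
    have "x = bottom_corner n l \<or> x = bottom_corner n (Suc l) \<or>
        x = top_corner n l \<or> x = top_corner n (Suc l)"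
      using that(2) by (auto simp: square_def)
    moreover have "l \<le> Suc n" "Suc l \<le> Suc n" using that(1) by (simp_all add: site_def)
    ultimately show ?thesis using corner by blast
  qed
  show ?thesis
  proof (cases "a \<and> b")
    case False
    then show ?thesis
    proof (cases a)
      case True
      then show ?thesis using False string s(2) x(2) by simp
    next
      case False
      then show ?thesis using string s(1) x(1) by simp
    qed
  next
    case True
    have "bottom_corner n k = 3 * k - 2" if "k \<le> n" for k
      using that by (simp add: bottom_corner_def)
    moreover have "x = 3 * i - 2 \<or> x = 3 * i + 1"
      using True x ne s by (auto simp: square_def site_def; presburger)
    ultimately have "x = bottom_corner n i \<or> x = bottom_corner n (Suc i)"
      using s True by (auto simp: site_def)
    then show ?thesis using corner[of i] corner[of "Suc i"] s by (auto simp: site_def)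
  qed
qed

lemma sides_memE:
  assumes "e \<in> sides S"
  obtains x y where "e = {x, y}" "x \<in> S" "y \<in> S" "x \<noteq> y"
  using assms unfolding sides_def by blast

definition joins :: "nat \<Rightarrow> nat set \<Rightarrow> nat set \<Rightarrow> nat set \<Rightarrow> bool" where
  "joins n e u v \<longleftrightarrow>
     (\<exists>i<n. e = gate n i \<and> {u, v} = {square n i False, square n (Suc i) False}) \<or>
     (\<exists>i. 0 < i \<and> i < n \<and> e = hatch n i \<and> {u, v} = {square n i False, square n i True})"

text \<open>A common side has two vertices, both of them shared corners, and two distinct squares share two corners
only if they are consecutive in the string or lie in the same column.\<close>

lemma common_side_joins:
  assumes n: "1 \<le> n" and s: "site n i a" "site n j b" and ne: "(i, a) \<noteq> (j, b)"
    and e: "e \<in> sides (square n i a)" "e \<in> sides (square n j b)"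
  shows "joins n e (square n i a) (square n j b)"
proof -
  obtain x y where xy: "e = {x, y}" "x \<noteq> y" "x \<in> square n i a" "y \<in> square n i a"
    using e(1) by (rule sides_memE)
  have "e \<subseteq> square n j b" using e(2) by (auto elim: sides_memE)
  then have xy': "x \<in> square n j b" "y \<in> square n j b" using xy by auto
  obtain k where k: "k = i \<or> k = Suc i" "k = j \<or> k = Suc j"
    "x = bottom_corner n k \<or> \<not> a \<and> \<not> b \<and> x = top_corner n k"
    using square_inter[OF n s ne xy(3) xy'(1)] by blast
  obtain l where l: "l = i \<or> l = Suc i" "l = j \<or> l = Suc j"
    "y = bottom_corner n l \<or> \<not> a \<and> \<not> b \<and> y = top_corner n l"
    using square_inter[OF n s ne xy(4) xy'(2)] by blast
  show ?thesis
  proof (cases "i = j")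
    case True
    then have ab: "a \<noteq> b" using ne by auto
    then have i: "0 < i" "i < n" using s True by (auto simp: site_def)
    have "e = hatch n i" using k l ab xy(1,2) by (auto simp: hatch_def)
    moreover have "{square n i a, square n j b} = {square n i False, square n i True}"
      using True ab by (cases a) auto
    ultimately show ?thesis using i unfolding joins_def by blast
  next
    case False
    then have kl: "k = l" "(j = Suc i \<and> k = j) \<or> (i = Suc j \<and> k = i)" using k l by auto
    then have ab: "\<not> a" "\<not> b" using k(3) l(3) xy(2) by auto
    have e: "e = {bottom_corner n k, top_corner n k}" using k(3) l(3) kl(1) xy(1,2) by auto
    from kl(2) show ?thesis
    proof (elim disjE conjE)
      assume "j = Suc i" "k = j"
      then show ?thesis using ab e s unfolding joins_def gate_def site_def
        by (intro disjI1 exI[of _ i]) auto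
    next
      assume "i = Suc j" "k = i"
      then show ?thesis using ab e s unfolding joins_def gate_def site_def
        by (intro disjI1 exI[of _ j]) auto
    qed
  qed
qed

lemma gate_diagonal: "i < n \<Longrightarrow> gate n i \<in> diagonals (L n)"
  by (auto simp: L_def gate_def)

lemma hatch_diagonal: "0 < i \<Longrightarrow> i < n \<Longrightarrow> hatch n i \<in> diagonals (L n)"
  by (force simp: L_def hatch_def)

lemma diagonal_in_square_side:
  assumes "1 \<le> n" "site n i b" "d \<in> diagonals (L n)" "d \<subseteq> square n i b"
  shows "d \<in> sides (square n i b)"
proof -
  have "square n i b \<in> squares (L n)" using assms(2) squares_L_sites[OF assms(1)] by auto
  then show ?thesis using assms(3,4) unfolding squares_def mem_Collect_eq by simp
qed

lemma joinsE:
  assumes "joins n e u v"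
  obtains i a j b where "u = square n i a" "v = square n j b" "site n i a" "site n j b"
    "(i, a) \<noteq> (j, b)" "e \<subseteq> u" "e \<subseteq> v" "e \<in> diagonals (L n)"
proof -
  have "\<exists>i a j b. u = square n i a \<and> v = square n j b \<and> site n i a \<and> site n j b \<and>
    (i, a) \<noteq> (j, b) \<and> e \<subseteq> u \<and> e \<subseteq> v \<and> e \<in> diagonals (L n)"
    using assms unfolding joins_def
  proof (elim disjE exE conjE)
    fix i assume i: "i < n" "e = gate n i" "{u, v} = {square n i False, square n (Suc i) False}"
    have g: "gate n i \<subseteq> square n i False" "gate n i \<subseteq> square n (Suc i) False"
      unfolding gate_def square_def by simp_all
    have s: "site n i False" "site n (Suc i) False" using i by (auto simp: site_def)
    from i(3)[unfolded doubleton_eq_iff]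
    consider "u = square n i False" "v = square n (Suc i) False"
      | "u = square n (Suc i) False" "v = square n i False"
      by (elim disjE conjE) (rule that; assumption)+
    then show ?thesis
    proof cases
      case 1 then show ?thesis using g s gate_diagonal[OF i(1)] i(2)
        by (intro exI[of _ i] exI[of _ False] exI[of _ "Suc i"]) simp
    next
      case 2 then show ?thesis using g s gate_diagonal[OF i(1)] i(2)
        by (intro exI[of _ "Suc i"] exI[of _ False] exI[of _ i]) simp
    qed
  next
    fix i assume i: "0 < i" "i < n" "e = hatch n i" "{u, v} = {square n i False, square n i True}"
    have g: "hatch n i \<subseteq> square n i False" "hatch n i \<subseteq> square n i True"
      using i(1,2) by (auto simp: hatch_def square_def bottom_corner_def)
    have s: "site n i False" "site n i True" using i by (auto simp: site_def)
    from i(4)[unfolded doubleton_eq_iff]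
    consider "u = square n i False" "v = square n i True"
      | "u = square n i True" "v = square n i False"
      by (elim disjE conjE) (rule that; assumption)+
    then show ?thesis
    proof cases
      case 1 then show ?thesis using g s hatch_diagonal[OF i(1,2)] i(3)
        by (intro exI[of _ i] exI[of _ False] exI[of _ True]) simp
    next
      case 2 then show ?thesis using g s hatch_diagonal[OF i(1,2)] i(3)
        by (intro exI[of _ i] exI[of _ True] exI[of _ False]) simp
    qed
  qed
  then show thesis by (elim exE conjE) (rule that)
qed

lemma joins_imp_adjacent:
  assumes "1 \<le> n" "joins n e u v"
  shows "adjacent (L n) u v \<and> e \<in> sides u \<inter> sides v"
  using assms(2)
proof (rule joinsE)
  fix i a j b
  assume uv: "u = square n i a" "v = square n j b" and s: "site n i a" "site n j b"
    and ne: "(i, a) \<noteq> (j, b)" and e: "e \<subseteq> u" "e \<subseteq> v" "e \<in> diagonals (L n)"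
  have "e \<in> sides u" "e \<in> sides v"
    using diagonal_in_square_side[OF assms(1)] s e uv by simp_all
  moreover have "u \<noteq> v" using square_eq_iff[OF assms(1) s] ne uv by simp
  moreover have "u \<in> squares (L n)" "v \<in> squares (L n)"
    using s uv squares_L_sites[OF assms(1)] by auto
  ultimately show ?thesis unfolding adjacent_def using e(3) by blast
qed

lemma adjacent_common_side_joins:
  assumes "1 \<le> n" "adjacent (L n) u v" "e \<in> sides u" "e \<in> sides v"
  shows "joins n e u v"
proof -
  obtain i a j b where "u = square n i a" "v = square n j b" "site n i a" "site n j b" "u \<noteq> v"
    using assms(2) unfolding adjacent_def squares_L_sites[OF assms(1)] by blast
  then show ?thesis using common_side_joins[OF assms(1), of i a j b e] assms(3,4) by blast
qed

lemma adjacent_iff_joins: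
  assumes "1 \<le> n"
  shows "adjacent (L n) u v \<longleftrightarrow> (\<exists>e. joins n e u v)"
proof
  assume adj: "adjacent (L n) u v"
  then obtain e where "e \<in> sides u" "e \<in> sides v" unfolding adjacent_def by blast
  then show "\<exists>e. joins n e u v" using adjacent_common_side_joins[OF assms adj] by blast
qed (use joins_imp_adjacent[OF assms] in blast)

lemma adjacent_common_side_iff:
  assumes "1 \<le> n" "adjacent (L n) u v"
  shows "e \<in> sides u \<inter> sides v \<longleftrightarrow> joins n e u v"
  using adjacent_common_side_joins[OF assms] joins_imp_adjacent[OF assms(1)] by blast

lemma gate_eq_iff: "1 \<le> n \<Longrightarrow> i < n \<Longrightarrow> j < n \<Longrightarrow> gate n i = gate n j \<longleftrightarrow> i = j"
  by (auto simp: gate_def doubleton_eq_iff corner_eq_iff)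

lemma hatch_eq_iff: "1 \<le> n \<Longrightarrow> i < n \<Longrightarrow> j < n \<Longrightarrow> hatch n i = hatch n j \<longleftrightarrow> i = j"
  by (auto simp: hatch_def doubleton_eq_iff corner_eq_iff)

lemma gate_neq_hatch:
  "1 \<le> n \<Longrightarrow> i < n \<Longrightarrow> j < n \<Longrightarrow> gate n i \<noteq> hatch n j"
  "1 \<le> n \<Longrightarrow> i < n \<Longrightarrow> j < n \<Longrightarrow> hatch n j \<noteq> gate n i"
  by (auto simp: hatch_def gate_def doubleton_eq_iff corner_eq_iff corner_eq_iff(3)[symmetric])

section \<open>Paths and cuts\<close>

text \<open>If \<open>u\<close> and \<open>v\<close> are the only adjacent squares on different sides of a cut \<open>P\<close>, a path changes the side
exactly when it steps between \<open>u\<close> and \<open>v\<close>. It can do so only once, because after the step one of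
them lies behind it. This replaces uniqueness of paths in a tree.\<close>

lemma path_cut_iff:
  assumes R: "\<And>x y. R x y \<Longrightarrow> (x \<in> P) \<noteq> (y \<in> P) \<longleftrightarrow> {x, y} = {u, v}"
    and p: "p \<noteq> []" "distinct p" "\<And>k. Suc k < length p \<Longrightarrow> R (p ! k) (p ! Suc k)"
  shows "(hd p \<in> P) \<noteq> (last p \<in> P) \<longleftrightarrow> (\<exists>k. Suc k < length p \<and> {p ! k, p ! Suc k} = {u, v})"
  using p
proof (induction p rule: induct_list012)
  case (3 x y r)
  let ?step = "\<lambda>p. \<exists>k. Suc k < length p \<and> {p ! k, p ! Suc k} = {u, v}"
  have "R ((y # r) ! k) ((y # r) ! Suc k)" if "Suc k < length (y # r)" for k
    using "3.prems"(3)[of "Suc k"] that by simp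
  then have IH: "(y \<in> P) \<noteq> (last (y # r) \<in> P) \<longleftrightarrow> ?step (y # r)"
    using "3.IH"(2) "3.prems"(2) by simp
  have xy: "(x \<in> P) \<noteq> (y \<in> P) \<longleftrightarrow> {x, y} = {u, v}" using R "3.prems"(3)[of 0] by simp
  have split: "?step (x # y # r) \<longleftrightarrow> {x, y} = {u, v} \<or> ?step (y # r)"
  proof
    assume "?step (x # y # r)"
    then obtain k where "Suc k < length (x # y # r)" "{(x # y # r) ! k, (x # y # r) ! Suc k}
        = {u, v}"
      by blast
    then show "{x, y} = {u, v} \<or> ?step (y # r)" by (cases k) auto
  next
    assume "{x, y} = {u, v} \<or> ?step (y # r)"
    then show "?step (x # y # r)"
    proof
      assume "{x, y} = {u, v}" then show ?thesis by (intro exI[of _ 0]) simp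
    next
      assume "?step (y # r)"
      then obtain k where "Suc k < length (y # r)" "{(y # r) ! k, (y # r) ! Suc k}
          = {u, v}" by blast
      then show ?thesis by (intro exI[of _ "Suc k"]) simp
    qed
  qed
  have once: "\<not> ?step (y # r)" if "{x, y} = {u, v}"
  proof
    assume "?step (y # r)"
    then obtain k where k: "Suc k < length (y # r)" "{(y # r) ! k, (y # r) ! Suc k}
        = {u, v}" by blast
    have "{(y # r) ! k, (y # r) ! Suc k} \<subseteq> set (y # r)" using k(1) nth_mem[of k
        "y # r"] nth_mem[of "Suc k" "y # r"] by auto
    then show False using k(2) that "3.prems"(2) by auto
  qed
  \<comment> \<open>Here \<open>c\<close> and \<open>d\<close> stand for a step between \<open>u\<close> and \<open>v\<close> now and later, which exclude each other.\<close>
  have parity: "(a \<noteq> e) = s" if "c \<Longrightarrow> \<not> d" "s = (c \<or> d)" "(a \<noteq> b) = c" "(b \<noteq> e) = d"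
    for a b c d e s :: bool using that by blast
  have "(x \<in> P) \<noteq> (last (y # r) \<in> P) \<longleftrightarrow> ?step (x # y # r)"
    by (rule parity[OF once split xy IH])
  then show ?case by simp
qed auto


lemma site_string: "site n i a \<Longrightarrow> site n i False"
  by (simp add: site_def)

lemma joins_gate_iff:
  assumes "1 \<le> n" "i < n"
  shows "joins n (gate n i) u v \<longleftrightarrow> {u, v} = {square n i False, square n (Suc i) False}"
  unfolding joins_def
  using assms(2) gate_eq_iff[OF assms(1) assms(2)] gate_neq_hatch(1)[OF assms(1) assms(2)] by metis

lemma joins_hatch_iff:
  assumes "1 \<le> n" "0 < i" "i < n"
  shows "joins n (hatch n i) u v \<longleftrightarrow> {u, v} = {square n i False, square n i True}"
  unfolding joins_def
  using assms(2,3) hatch_eq_iff[OF assms(1) assms(3)] gate_neq_hatch(2)[OF assms(1) _ assms(3)]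
  by metis

lemma path_sides_iff_joins:
  assumes "1 \<le> n" "square_path (L n) p"
  shows "e \<in> path_sides p q \<longleftrightarrow> (\<exists>k. Suc k < length p \<and> q \<in> {p ! k, p ! Suc k}
      \<and> joins n e (p ! k) (p ! Suc k))"
proof -
  have "e \<in> sides (p ! k) \<inter> sides (p ! Suc k) \<longleftrightarrow> joins n e (p ! k) (p ! Suc k)" if
      "Suc k < length p" for k
    using adjacent_common_side_iff[OF assms(1)] assms(2) that unfolding square_path_def by blast
  then show ?thesis unfolding path_sides_def by auto
qed

lemma adjacent_cases:
  assumes "1 \<le> n" "adjacent (L n) u v"
  obtains i where "i < n" "{u, v} = {square n i False, square n (Suc i) False}"
  | i where "0 < i" "i < n" "{u, v} = {square n i False, square n i True}"
  using assms(2) unfolding adjacent_iff_joins[OF assms(1)] joins_def by blast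

text \<open>Each gate is the only way from the columns up to it to the remaining ones, and each hatch is the only
way into its extra square (\<open>extra_cut\<close> below).\<close>

lemma column_cut:
  assumes n: "1 \<le> n" and k: "k < n" and adj: "adjacent (L n) u v"
    and P: "P = {square n l c | l c. site n l c \<and> l \<le> k}"
  shows "(u \<in> P) \<noteq> (v \<in> P) \<longleftrightarrow> {u, v} = {square n k False, square n (Suc k) False}"
proof -
  have mem: "square n l c \<in> P \<longleftrightarrow> l \<le> k" if "site n l c" for l c
    unfolding P using square_eq_iff[OF n that] that by blast
  from n adj show ?thesis
  proof (cases rule: adjacent_cases)
    case (1 i)
    have s: "site n i False" "site n (Suc i) False" "site n k False" "site n (Suc k) False"
      using 1(1) k by (auto simp: site_def)
    have "{u, v} = {square n k False, square n (Suc k) False} \<longleftrightarrow> i = k"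
      unfolding 1(2) doubleton_eq_iff using square_eq_iff[OF n s(1)]
          square_eq_iff[OF n s(2)] s by auto
    moreover have "(u \<in> P) \<noteq> (v \<in> P) \<longleftrightarrow> i = k"
      using 1(2)[unfolded doubleton_eq_iff] mem[OF s(1)] mem[OF s(2)] by auto
    ultimately show ?thesis by simp
  next
    case (2 i)
    have s: "site n i False" "site n i True" "site n k False" "site n (Suc k) False"
      using 2 k by (auto simp: site_def)
    have "{u, v} \<noteq> {square n k False, square n (Suc k) False}"
      unfolding 2(3) doubleton_eq_iff using square_eq_iff[OF n s(2)] s by auto
    moreover have "u \<in> P \<longleftrightarrow> v \<in> P"
      using 2(3)[unfolded doubleton_eq_iff] mem[OF s(1)] mem[OF s(2)] by auto
    ultimately show ?thesis by simp
  qed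
qed

lemma extra_cut:
  assumes n: "1 \<le> n" and k: "0 < k" "k < n" and adj: "adjacent (L n) u v"
  shows "(u \<in> {square n k True}) \<noteq> (v \<in> {square n k True}) \<longleftrightarrow>
    {u, v} = {square n k False, square n k True}"
proof -
  have sk: "site n k False" "site n k True" using k by (auto simp: site_def)
  from n adj show ?thesis
  proof (cases rule: adjacent_cases)
    case (1 i)
    have s: "site n i False" "site n (Suc i) False"
      using 1(1) k by (auto simp: site_def)
    have ne: "square n i False \<noteq> square n k True" "square n (Suc i) False \<noteq> square n k True"
      using square_eq_iff[OF n s(1) sk(2)] square_eq_iff[OF n s(2) sk(2)] by simp_all
    then have "{u, v} \<noteq> {square n k False, square n k True}"
      unfolding 1(2) doubleton_eq_iff by metis
    moreover have "u \<noteq> square n k True" "v \<noteq> square n k True"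
      using 1(2)[unfolded doubleton_eq_iff] ne by metis+
    ultimately show ?thesis by simp
  next
    case (2 i)
    have s: "site n i False" "site n i True"
      using 2 k by (auto simp: site_def)
    have eq: "square n i False \<noteq> square n k True" "square n i True \<noteq> square n k False"
      "square n i False = square n k False \<longleftrightarrow> i = k" "square n i True = square n k True \<longleftrightarrow> i = k"
      using square_eq_iff[OF n s(1) sk(2)] square_eq_iff[OF n s(2) sk(2)]
        square_eq_iff[OF n s(1) sk(1)] square_eq_iff[OF n s(2) sk(1)] by simp_all
    then have "{u, v} = {square n k False, square n k True} \<longleftrightarrow> i = k"
      unfolding 2(3) doubleton_eq_iff by metis
    moreover have "(u = square n k True) \<noteq> (v = square n k True) \<longleftrightarrow> i = k"
      using 2(3)[unfolded doubleton_eq_iff] eq by metis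
    ultimately show ?thesis by simp
  qed
qed

text \<open>The gates and hatches at the square \<open>q\<close> that separate the squares \<open>(i, a)\<close> and \<open>(j, b)\<close>: these
are the sides through which the path between the two squares enters or leaves \<open>q\<close>.\<close>

definition cuts :: "nat \<Rightarrow> nat \<Rightarrow> bool \<Rightarrow> nat \<Rightarrow> bool \<Rightarrow> nat set \<Rightarrow> nat set \<Rightarrow> bool" where
  "cuts n i a j b q e \<longleftrightarrow>
     (\<exists>k<n. e = gate n k \<and> q \<in> {square n k False, square n (Suc k) False} \<and>
        (i \<le> k) \<noteq> (j \<le> k)) \<or>
     (\<exists>k. 0 < k \<and> k < n \<and> e = hatch n k \<and> q \<in> {square n k False, square n k True} \<and>
        (k = i \<and> a) \<noteq> (k = j \<and> b))"

lemma cuts_commute: "cuts n i a j b = cuts n j b i a"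
proof -
  have "((i \<le> k) \<noteq> (j \<le> k)) = ((j \<le> k) \<noteq> (i \<le> k))"
    "((k = i \<and> a) \<noteq> (k = j \<and> b)) = ((k = j \<and> b) \<noteq> (k = i \<and> a))" for k by blast+
  then show ?thesis unfolding cuts_def by simp
qed

lemma path_sides_eq_cuts:
  assumes n: "1 \<le> n" and p: "square_path (L n) p"
    and s: "site n i a" "site n j b"
    and ends: "hd p = square n i a" "last p = square n j b"
  shows "path_sides p q = {e. cuts n i a j b q e}"
proof -
  have chain: "p \<noteq> []" "distinct p" "\<And>k. Suc k < length p \<Longrightarrow> adjacent (L n) (p ! k) (p ! Suc k)"
    using p by (auto simp: square_path_def)
  have step: "e \<in> path_sides p q \<longleftrightarrow> q \<in> {u, v} \<and> (\<exists>k. Suc k < length p \<and> {p ! k, p ! Suc k}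
      = {u, v})"
    if "\<And>x y. joins n e x y \<longleftrightarrow> {x, y} = {u, v}" for e u v
    unfolding path_sides_iff_joins[OF n p] that by metis
  have gate: "gate n k \<in> path_sides p q \<longleftrightarrow>
      q \<in> {square n k False, square n (Suc k) False} \<and> (i \<le> k) \<noteq> (j \<le> k)" if k: "k < n" for k
  proof -
    define P where "P = {square n l c | l c. site n l c \<and> l \<le> k}"
    have mem: "square n l c \<in> P \<longleftrightarrow> l \<le> k" if "site n l c" for l c
      unfolding P_def using square_eq_iff[OF n that] that by blast
    have "(hd p \<in> P) \<noteq> (last p \<in> P) \<longleftrightarrow>
        (\<exists>l. Suc l < length p \<and> {p ! l, p ! Suc l} = {square n k False, square n (Suc k) False})"
      by (rule path_cut_iff[where R = "adjacent (L n)", OF _ chain]) (rule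
          column_cut[OF n k _ P_def])
    then show ?thesis
      unfolding step[OF joins_gate_iff[OF n k]] ends mem[OF s(1)] mem[OF s(2)] by blast
  qed
  have hatch: "hatch n k \<in> path_sides p q \<longleftrightarrow>
      q \<in> {square n k False, square n k True} \<and> (k = i \<and> a) \<noteq> (k = j \<and> b)"
    if k: "0 < k" "k < n" for k
  proof -
    have mem: "square n l c \<in> {square n k True} \<longleftrightarrow> k = l \<and> c" if "site n l c" for l c
      using square_eq_iff[OF n that, of k True] k by (auto simp: site_def)
    have "(hd p \<in> {square n k True}) \<noteq> (last p \<in> {square n k True}) \<longleftrightarrow>
        (\<exists>l. Suc l < length p \<and> {p ! l, p ! Suc l} = {square n k False, square n k True})"
      by (rule path_cut_iff[where R = "adjacent (L n)", OF _ chain]) (rule extra_cut[OF n k])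
    then show ?thesis
      unfolding step[OF joins_hatch_iff[OF n k]] ends mem[OF s(1)] mem[OF s(2)] by blast
  qed
  have "e \<in> path_sides p q \<longleftrightarrow> cuts n i a j b q e" for e
  proof
    assume e: "e \<in> path_sides p q"
    then obtain u v where "joins n e u v" using path_sides_iff_joins[OF n p] by blast
    then consider k where "k < n" "e = gate n k" | k where "0 < k" "k < n" "e = hatch n k"
      unfolding joins_def by blast
    then show "cuts n i a j b q e"
    proof cases
      case 1 then show ?thesis using e gate unfolding cuts_def by blast
    next
      case 2 then show ?thesis using e hatch unfolding cuts_def by blast
    qed
  next
    assume "cuts n i a j b q e"
    then show "e \<in> path_sides p q" unfolding cuts_def using gate hatch by blast
  qed
  then show ?thesis by blast
qed

lemma serpent_sides_eq_cuts:
  assumes n: "1 \<le> n" and s: "site n i a" "site n j b"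
    and p: "square_path (L n) p" "hd p = square n i a" "last p = square n j b"
  shows "serpent_sides (L n) {square n i a, square n j b} q = {e. cuts n i a j b q e}"
proof -
  have "path_sides r q = {e. cuts n i a j b q e}"
    if r: "square_path (L n) r" "{square n i a, square n j b} = {hd r, last r}" for r
  proof -
    from r(2) consider "hd r = square n i a" "last r = square n j b"
      | "hd r = square n j b" "last r = square n i a" unfolding doubleton_eq_iff by metis
    then show ?thesis
    proof cases
      case 1 then show ?thesis by (rule path_sides_eq_cuts[OF n r(1) s])
    next
      case 2 then show ?thesis
        using path_sides_eq_cuts[OF n r(1) s(2,1)] unfolding cuts_commute[of n i a] by blast
    qed
  qed
  then show ?thesis unfolding serpent_sides_def using p by auto
qed

lemma square_path_singleton: "q \<in> squares Q \<Longrightarrow> square_path Q [q]"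
  by (simp add: square_path_def)

lemma square_path_Cons:
  assumes "adjacent Q q (hd p)" "q \<notin> set p" "square_path Q p"
  shows "square_path Q (q # p)"
proof -
  have "adjacent Q ((q # p) ! i) ((q # p) ! Suc i)" if "Suc i < length (q # p)" for i
    using assms that by (cases i) (auto simp: square_path_def hd_conv_nth)
  moreover have "q \<in> squares Q" using assms(1) by (simp add: adjacent_def)
  ultimately show ?thesis using assms(2,3) by (simp add: square_path_def)
qed

section \<open>The serpents of the Lucas quadrangulation\<close>

definition link :: "nat \<Rightarrow> nat \<Rightarrow> bool \<Rightarrow> bool \<Rightarrow> nat set set" where
  "link n i a b = {square n i a, square n (Suc i) b}"

definition stub :: "nat \<Rightarrow> nat \<Rightarrow> nat set set" where
  "stub n i = {square n i False, square n i True}"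

lemma adjacent_string: "1 \<le> n \<Longrightarrow> i < n \<Longrightarrow> adjacent (L n) (square n i False) (square n (Suc i) False)"
  unfolding adjacent_iff_joins using joins_gate_iff by blast

lemma adjacent_extra:
  assumes "1 \<le> n" "site n i True"
  shows "adjacent (L n) (square n i False) (square n i True)"
    and "adjacent (L n) (square n i True) (square n i False)"
  unfolding adjacent_iff_joins[OF assms(1)]
  using joins_hatch_iff[OF assms(1), of i] assms(2) unfolding site_def by blast+

lemma ex_link_path:
  assumes n: "1 \<le> n" and s: "site n i a" "site n (Suc i) b"
  shows "\<exists>p. square_path (L n) p \<and> hd p = square n i a \<and> last p = square n (Suc i) b"
proof -
  have i: "i < n" using s by (simp add: site_def)
  have sF: "site n i False" "site n (Suc i) False" using i by (auto simp: site_def)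
  have neq: "square n j c \<noteq> square n k d" if "site n j c" "site n k d" "\<not> (j = k \<and> c = d)"
      for j k c d
    using square_eq_iff[OF n that(1,2)] that(3) by simp
  define r where "r = (if b then [square n (Suc i) False, square n (Suc i) True] else [square n (Suc i) False])"
  have sq: "square n j c \<in> squares (L n)" if "site n j c" for j c
    using that squares_L_sites[OF n] by blast
  have r: "square_path (L n) r" "hd r = square n (Suc i) False" "last r = square n (Suc i) b"
    using s(2) adjacent_extra[OF n] neq[OF sF(2), of "Suc i" True] sq[OF sF(2)] sq[OF s(2)]
    unfolding r_def by (cases b; auto intro!: square_path_Cons square_path_singleton)+
  have r_set: "q \<in> set r \<Longrightarrow> \<exists>c. site n (Suc i) c \<and> q = square n (Suc i) c" for q
    using s(2) sF(2) unfolding r_def by (cases b) auto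
  have r': "square_path (L n) (square n i False # r)"
  proof (rule square_path_Cons[OF _ _ r(1)])
    show "adjacent (L n) (square n i False) (hd r)" using adjacent_string[OF n i] r(2) by simp
    show "square n i False \<notin> set r" using r_set neq[OF sF(1)] by fastforce
  qed
  have rne: "r \<noteq> []" by (simp add: r_def)
  show ?thesis
  proof (cases a)
    case False
    then show ?thesis using r' r rne by (intro exI[of _ "square n i False # r"]) simp
  next
    case True
    have "square_path (L n) (square n i True # square n i False # r)"
    proof (rule square_path_Cons[OF _ _ r'])
      show "adjacent (L n) (square n i True) (hd (square n i False # r))"
        using adjacent_extra[OF n] s(1) True by simp
      have "square n i True \<notin> set r" using r_set neq[OF s(1)] True by fastforce
      then show "square n i True \<notin> set (square n i False # r)" using neq[OF s(1) sF(1)] True by simp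
    qed
    then show ?thesis using True r rne by (intro exI[of _
        "square n i True # square n i False # r"]) simp
  qed
qed

lemma ex_stub_path:
  assumes n: "1 \<le> n" and s: "site n i True"
  shows "\<exists>p. square_path (L n) p \<and> hd p = square n i False \<and> last p = square n i True"
proof -
  have sF: "site n i False" using s by (simp add: site_def)
  have "square_path (L n) [square n i False, square n i True]"
    using adjacent_extra[OF n s] square_eq_iff[OF n sF s] s squares_L_sites[OF n]
    by (intro square_path_Cons square_path_singleton) auto
  then show ?thesis by (intro exI[of _ "[square n i False, square n i True]"]) simp
qed

lemma link_sides_iff:
  assumes n: "1 \<le> n" and s: "site n i a" "site n (Suc i) b"
  shows "e \<in> serpent_sides (L n) (link n i a b) q \<longleftrightarrow>
    e = gate n i \<and> q \<in> {square n i False, square n (Suc i) False} \<or>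
    a \<and> e = hatch n i \<and> q \<in> {square n i False, square n i True} \<or>
    b \<and> e = hatch n (Suc i) \<and> q \<in> {square n (Suc i) False, square n (Suc i) True}"
proof -
  obtain p where "square_path (L n) p" "hd p = square n i a" "last p = square n (Suc i) b"
    using ex_link_path[OF assms] by blast
  note serpent_sides_eq_cuts[OF n s this]
  moreover have "(i \<le> k) \<noteq> (Suc i \<le> k) \<longleftrightarrow> k = i" for k by auto
  ultimately show ?thesis using s unfolding link_def cuts_def site_def by auto
qed

lemma stub_sides_iff:
  assumes n: "1 \<le> n" and s: "site n i True"
  shows "e \<in> serpent_sides (L n) (stub n i) q \<longleftrightarrow>
    e = hatch n i \<and> q \<in> {square n i False, square n i True}"
proof -
  have sF: "site n i False" using s by (simp add: site_def)
  obtain p where "square_path (L n) p" "hd p = square n i False" "last p = square n i True"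
    using ex_stub_path[OF assms] by blast
  note serpent_sides_eq_cuts[OF n sF s this]
  then show ?thesis using s unfolding stub_def cuts_def site_def by auto
qed

lemma set_path_squares: "square_path Q p \<Longrightarrow> q \<in> set p \<Longrightarrow> q \<in> squares Q"
  by (auto simp: square_path_def)

text \<open>A path that reaches the second column after \<open>i\<close> passes the two gates of column \<open>i + 1\<close>, which are
opposite sides of its square in the string.\<close>

lemma bent_path_columns:
  assumes n: "1 \<le> n" and j: "j \<le> n"
    and cut: "\<And>q. path_sides p q = {e. cuts n i a j b q e}"
    and bend: "\<forall>q\<in>set p. \<forall>e\<in>path_sides p q. \<forall>f\<in>path_sides p q. \<not> opposite e f"
  shows "j \<le> Suc i"
proof (rule ccontr)
  assume far: "\<not> j \<le> Suc i"
  let ?q = "square n (Suc i) False"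
  have "cuts n i a j b ?q (gate n i)"
    unfolding cuts_def using far j by (intro disjI1 exI[of _ i]) simp
  moreover have "cuts n i a j b ?q (gate n (Suc i))"
    unfolding cuts_def using far j by (intro disjI1 exI[of _ "Suc i"]) simp
  ultimately have ps: "gate n i \<in> path_sides p ?q" "gate n (Suc i) \<in> path_sides p ?q"
    unfolding cut by simp_all
  then have "?q \<in> set p" unfolding path_sides_def by (auto intro: nth_mem)
  then have "\<not> opposite (gate n i) (gate n (Suc i))" using bend ps by blast
  moreover have "opposite (gate n i) (gate n (Suc i))"
    unfolding opposite_def gate_def using n far j
    by (auto simp: corner_eq_iff corner_eq_iff(3)[symmetric])
  ultimately show False ..
qed

text \<open>The ends are at most one column apart by \<open>bent_path_columns\<close>. Conversely, all sides used by a link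
contain the bottom corner of its gate, and a stub uses a single side, so no two of them are opposite.\<close>

lemma serpent_L_iff:
  assumes n: "1 \<le> n"
  shows "serpent (L n) S \<longleftrightarrow>
    (\<exists>i a b. site n i a \<and> site n (Suc i) b \<and> S = link n i a b) \<or> (\<exists>i. site n i True \<and> S = stub n i)"
proof
  assume "serpent (L n) S"
  then obtain p where p: "square_path (L n) p" "hd p \<noteq> last p" "S = {hd p, last p}"
    and bend: "\<forall>q\<in>set p. \<forall>e\<in>path_sides p q. \<forall>f\<in>path_sides p q. \<not> opposite e f"
    unfolding serpent_def by blast
  have "p \<noteq> []" using p(1) by (simp add: square_path_def)
  then have "hd p \<in> squares (L n)" "last p \<in> squares (L n)"
    using set_path_squares[OF p(1)] by simp_all
  then obtain i a j b where ends: "hd p = square n i a" "last p = square n j b"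
    and s: "site n i a" "site n j b" unfolding squares_L_sites[OF n] by blast
  note cut = path_sides_eq_cuts[OF n p(1) s ends]
  have "i \<le> n" "j \<le> n" using s by (simp_all add: site_def)
  then have "j \<le> Suc i" "i \<le> Suc j"
    using bent_path_columns[OF n _ cut bend]
        bent_path_columns[OF n _ cut[unfolded cuts_commute[of n i]] bend]
    by blast+
  then consider "j = Suc i" | "i = Suc j" | "i = j" by linarith
  then show "(\<exists>i a b. site n i a \<and> site n (Suc i) b \<and> S = link n i a b) \<or> (\<exists>i. site n i True \<and> S
      = stub n i)"
  proof cases
    case 1 then show ?thesis using p(3) ends s unfolding link_def by blast
  next
    case 2 then show ?thesis using p(3) ends s unfolding link_def by (metis insert_commute)
  next
    case 3
    have "a \<noteq> b"
    proof
      assume "a = b" then show False using p(2) 3 unfolding ends by simp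
    qed
    then have "site n i True \<and> S = stub n i" using 3 s p(3) ends unfolding stub_def
      by (cases a; cases b) (simp_all add: insert_commute)
    then show ?thesis by blast
  qed
next
  \<comment> \<open>The vertex \<open>c\<close> will be a corner of all sides that the path uses.\<close>
  have bend: "serpent (L n) {square n i a, square n j b}"
    if s: "site n i a" "site n j b" "\<not> (i = j \<and> a = b)"
      and c: "\<And>q e. cuts n i a j b q e \<Longrightarrow> c \<in> e"
      and ex: "\<exists>p. square_path (L n) p \<and> hd p = square n i a \<and> last p = square n j b" for i a j b c
  proof -
    obtain p where p: "square_path (L n) p" "hd p = square n i a" "last p = square n j b"
        using ex by blast
    have "\<not> opposite e f" if "e \<in> path_sides p q" "f \<in> path_sides p q" for q e f
      using that c unfolding path_sides_eq_cuts[OF n p(1) s(1,2) p(2,3)] opposite_def by blast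
    moreover have "hd p \<noteq> last p" using square_eq_iff[OF n s(1,2)] s(3) p by simp
    ultimately show ?thesis unfolding serpent_def using p by metis
  qed
  assume "(\<exists>i a b. site n i a \<and> site n (Suc i) b \<and> S = link n i a b) \<or> (\<exists>i. site n i True \<and> S
      = stub n i)"
  then show "serpent (L n) S"
  proof (elim disjE exE conjE)
    fix i a b assume s: "site n i a" "site n (Suc i) b" and S: "S = link n i a b"
    have "(i \<le> k) \<noteq> (Suc i \<le> k) \<longleftrightarrow> k = i" for k by auto
    then have "bottom_corner n (Suc i) \<in> e" if "cuts n i a (Suc i) b q e" for q e
      using that unfolding cuts_def by (auto simp: gate_def hatch_def)
    then show ?thesis unfolding S link_def using s ex_link_path[OF n s] by (intro bend) auto
  next
    fix i assume s: "site n i True" and S: "S = stub n i"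
    have "bottom_corner n i \<in> e" if "cuts n i False i True q e" for q e
      using that unfolding cuts_def by (auto simp: hatch_def)
    moreover have "site n i False" using s by (simp add: site_def)
    ultimately show ?thesis unfolding S stub_def using s ex_stub_path[OF n s] by (intro bend) auto
  qed
qed


section \<open>Compatible sets of serpents\<close>

lemma link_eq_iff:
  assumes n: "1 \<le> n" and s: "site n i a" "site n (Suc i) b" "site n j c" "site n (Suc j) d"
  shows "link n i a b = link n j c d \<longleftrightarrow> i = j \<and> a = c \<and> b = d"
  unfolding link_def doubleton_eq_iff square_eq_iff[OF n s(1,3)] square_eq_iff[OF n s(1,4)]
    square_eq_iff[OF n s(2,3)] square_eq_iff[OF n s(2,4)] by auto

lemma stub_eq_iff:
  assumes n: "1 \<le> n" and s: "site n i True" "site n j True"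
  shows "stub n i = stub n j \<longleftrightarrow> i = j"
  unfolding stub_def doubleton_eq_iff square_eq_iff[OF n s(1,2)]
    square_eq_iff[OF n site_string[OF s(1)] s(2)]
    square_eq_iff[OF n site_string[OF s(1)] site_string[OF s(2)]] by auto

lemma link_neq_stub:
  assumes n: "1 \<le> n" and s: "site n i a" "site n (Suc i) b" "site n j True"
  shows "link n i a b \<noteq> stub n j"
  unfolding stub_def link_def doubleton_eq_iff square_eq_iff[OF n s(1,3)]
    square_eq_iff[OF n s(1) site_string[OF s(3)]]
    square_eq_iff[OF n s(2,3)] square_eq_iff[OF n s(2) site_string[OF s(3)]] by auto

text \<open>The side through which a link over the gate \<open>k\<close> leaves its extremity in column \<open>j\<close>; the only exit
of an extra square is its hatch.\<close>

definition exit_side :: "nat \<Rightarrow> nat \<Rightarrow> bool \<Rightarrow> nat \<Rightarrow> nat set" where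
  "exit_side n j c k = (if c then hatch n j else gate n k)"

lemma link_stop_iff:
  assumes n: "1 \<le> n" and s: "site n i a" "site n (Suc i) b" and q: "site n j c"
  shows "square n j c \<in> link n i a b \<and> e \<in> serpent_sides (L n) (link n i a b) (square n j c) \<longleftrightarrow>
    e = exit_side n j c i \<and> (j = i \<and> c = a \<or> j = Suc i \<and> c = b)"
proof -
  have sF: "site n i False" "site n (Suc i) False" using s by (auto intro: site_string)
  have a: "square n j c = square n i a \<longleftrightarrow> j = i \<and> c = a" "square n j c = square n (Suc i) b \<longleftrightarrow> j
      = Suc i \<and> c = b"
     "square n j c = square n i False \<longleftrightarrow> j = i \<and> \<not> c" "square n j c = square n (Suc i) False \<longleftrightarrow> j
         = Suc i \<and> \<not> c"
    using square_eq_iff[OF n q] s sF by simp_all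
  have b: "a \<Longrightarrow> square n j c = square n i True \<longleftrightarrow> j = i \<and> c"
    "b \<Longrightarrow> square n j c = square n (Suc i) True \<longleftrightarrow> j = Suc i \<and> c"
    using square_eq_iff[OF n q] s by simp_all
  show ?thesis
    unfolding link_sides_iff[OF n s] unfolding link_def insert_iff empty_iff a exit_side_def
    using b by (cases a; cases b; cases c) auto
qed

lemma stub_stop_iff:
  assumes n: "1 \<le> n" and s: "site n i True" and q: "site n j c"
  shows "square n j c \<in> stub n i \<and> e \<in> serpent_sides (L n) (stub n i) (square n j c) \<longleftrightarrow>
    e = hatch n i \<and> j = i"
  unfolding stub_sides_iff[OF n s] unfolding stub_def insert_iff empty_iff
    square_eq_iff[OF n q s] square_eq_iff[OF n q site_string[OF s]] by (cases c) auto

lemma link_turn_iff: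
  assumes n: "1 \<le> n" and s: "site n i a" "site n (Suc i) b" and q: "site n j c" and ef: "e \<noteq> f"
  shows "e \<in> serpent_sides (L n) (link n i a b) (square n j c) \<and>
      f \<in> serpent_sides (L n) (link n i a b) (square n j c) \<longleftrightarrow>
    \<not> c \<and> {e, f} = {gate n i, hatch n j} \<and> (j = i \<and> a \<or> j = Suc i \<and> b)"
proof -
  have sF: "site n i False" "site n (Suc i) False" using s by (auto intro: site_string)
  have a: "square n j c = square n i False \<longleftrightarrow> j = i \<and> \<not> c" "square n j c = square n (Suc i) False
      \<longleftrightarrow> j = Suc i \<and> \<not> c"
    using square_eq_iff[OF n q] s sF by simp_all
  have b: "a \<Longrightarrow> square n j c = square n i True \<longleftrightarrow> j = i \<and> c"
    "b \<Longrightarrow> square n j c = square n (Suc i) True \<longleftrightarrow> j = Suc i \<and> c"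
    using square_eq_iff[OF n q] s by simp_all
  have sides: "g \<in> serpent_sides (L n) (link n i a b) (square n j c) \<longleftrightarrow>
      g = gate n i \<and> (j = i \<or> j = Suc i) \<and> \<not> c \<or> g = hatch n j \<and> (j = i \<and> a \<or> j = Suc i \<and> b)" for g
    unfolding link_sides_iff[OF n s] insert_iff empty_iff a using b
    by (cases a; cases b; cases c) auto
  show ?thesis unfolding sides doubleton_eq_iff using ef by blast
qed

lemma stub_turn:
  assumes n: "1 \<le> n" and s: "site n i True" and ef: "e \<noteq> f"
  shows "\<not> (e \<in> serpent_sides (L n) (stub n i) q \<and> f \<in> serpent_sides (L n) (stub n i) q)"
  unfolding stub_sides_iff[OF n s] using ef by auto

definition linked :: "nat \<Rightarrow> nat set set set \<Rightarrow> nat \<Rightarrow> bool \<Rightarrow> bool \<Rightarrow> bool" where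
  "linked n A i a b \<longleftrightarrow> site n i a \<and> site n (Suc i) b \<and> link n i a b \<in> A"

definition stubbed :: "nat \<Rightarrow> nat set set set \<Rightarrow> nat \<Rightarrow> bool" where
  "stubbed n A i \<longleftrightarrow> site n i True \<and> stub n i \<in> A"

lemma serpentE:
  assumes "1 \<le> n" "A \<subseteq> {S. serpent (L n) S}" "S \<in> A"
  obtains i a b where "linked n A i a b" "S = link n i a b" | i where "stubbed n A i" "S = stub n i"
  using assms serpent_L_iff[OF assms(1), of S] unfolding linked_def stubbed_def by blast

lemma ex_serpent_iff:
  assumes "1 \<le> n" "A \<subseteq> {S. serpent (L n) S}"
  shows "(\<exists>S\<in>A. P S) \<longleftrightarrow> (\<exists>i a b. linked n A i a b \<and> P (link n i a b)) \<or> (\<exists>i. stubbed n A i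
      \<and> P (stub n i))"
proof
  assume "\<exists>S\<in>A. P S"
  then obtain S where S: "S \<in> A" "P S" by blast
  from assms S(1)
  show "(\<exists>i a b. linked n A i a b \<and> P (link n i a b)) \<or> (\<exists>i. stubbed n A i \<and> P (stub n i))"
  proof (cases rule: serpentE)
    case (1 i a b)
    then have "linked n A i a b \<and> P (link n i a b)" using S(2) by simp
    then show ?thesis by (intro disjI1 exI)
  next
    case (2 i)
    then have "stubbed n A i \<and> P (stub n i)" using S(2) by simp
    then show ?thesis by (intro disjI2 exI)
  qed
next
  assume "(\<exists>i a b. linked n A i a b \<and> P (link n i a b)) \<or> (\<exists>i. stubbed n A i \<and> P (stub n i))"
  then show "\<exists>S\<in>A. P S"
    by (elim disjE exE conjE) (rule bexI, assumption, simp add: linked_def stubbed_def)+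
qed

text \<open>The first two clauses say that the links through each gate form a partial matching, the others that an
extra square is the end of at most one serpent.\<close>

definition noncolliding :: "nat \<Rightarrow> nat set set set \<Rightarrow> bool" where
  "noncolliding n A \<longleftrightarrow>
     (\<forall>i a b c. linked n A i a b \<and> linked n A i a c \<longrightarrow> b = c) \<and>
     (\<forall>i a b c. linked n A i a b \<and> linked n A i c b \<longrightarrow> a = c) \<and>
     (\<forall>i a b. \<not> (linked n A i a True \<and> linked n A (Suc i) True b)) \<and>
     (\<forall>i a. \<not> (linked n A i a True \<and> stubbed n A (Suc i))) \<and>
     (\<forall>i b. \<not> (linked n A i True b \<and> stubbed n A i))"

lemma compatibleD:
  assumes "A \<in> compatible_sets Q" "S \<in> A" "T \<in> A" "q \<in> S \<and> e \<in> serpent_sides Q S q"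
    "q \<in> T \<and> e \<in> serpent_sides Q T q"
  shows "S = T"
  using assms unfolding compatible_sets_def by blast

text \<open>An extremity in the string is left through a different side by links over different gates and by the
stub, so collisions there are between two links over the same gate. All serpents ending in an extra
square leave it through its hatch.\<close>

lemma compatible_L_iff:
  assumes n: "1 \<le> n"
  shows "A \<in> compatible_sets (L n) \<longleftrightarrow> A \<subseteq> {S. serpent (L n) S} \<and> noncolliding n A"
proof
  assume A: "A \<in> compatible_sets (L n)"
  note link_stop = link_stop_iff[OF n, THEN iffD2]
  have ll: "link n i a b = link n i' a' b'"
    if "linked n A i a b" "linked n A i' a' b'" "site n j c" "exit_side n j c i
        = exit_side n j c i'"
      "j = i \<and> c = a \<or> j = Suc i \<and> c = b" "j = i' \<and> c = a' \<or> j = Suc i' \<and> c = b'"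
    for i a b i' a' b' j c
    using that unfolding linked_def
    by (intro compatibleD[OF A _ _ link_stop[of i a b j c "exit_side n j c i"]
          link_stop[of i' a' b' j c "exit_side n j c i"]]) auto
  have ls: "False" if "linked n A i a b" "stubbed n A j" "j = i \<and> a \<or> j = Suc i \<and> b" for i a b j
  proof -
    have s: "site n i a" "site n (Suc i) b" "site n j True"
      using that by (auto simp: linked_def stubbed_def)
    have "link n i a b = stub n j"
      using that s
      by (intro compatibleD[OF A _ _ link_stop[of i a b j True "hatch n j"]
            stub_stop_iff[OF n, THEN iffD2, of j j True "hatch n j"]])
        (auto simp: linked_def stubbed_def exit_side_def)
    then show False using link_neq_stub[OF n s] by simp
  qed
  have sites: "site n i a" "site n (Suc i) b" if "linked n A i a b" for i a b
    using that by (auto simp: linked_def)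
  have "b = c" if "linked n A i a b" "linked n A i a c" for i a b c
    using ll[OF that, of i a]
        link_eq_iff[OF n sites(1)[OF that(1)] sites(2)[OF that(1)] sites(1)[OF that(2)] sites(2)[OF that(2)]]
      sites[OF that(1)] by simp
  moreover have "a = c" if "linked n A i a b" "linked n A i c b" for i a b c
    using ll[OF that, of "Suc i" b]
        link_eq_iff[OF n sites(1)[OF that(1)] sites(2)[OF that(1)] sites(1)[OF that(2)] sites(2)[OF that(2)]]
      sites[OF that(1)] by simp
  moreover have False if "linked n A i a True" "linked n A (Suc i) True b" for i a b
    using ll[OF that, of "Suc i" True]
        link_eq_iff[OF n sites(1)[OF that(1)] sites(2)[OF that(1)] sites(1)[OF that(2)] sites(2)[OF that(2)]]
      sites[OF that(1)] by (simp add: exit_side_def)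
  ultimately have "noncolliding n A" unfolding noncolliding_def using ls by blast
  then show "A \<subseteq> {S. serpent (L n) S} \<and> noncolliding n A"
    using A by (simp add: compatible_sets_def)
next
  assume "A \<subseteq> {S. serpent (L n) S} \<and> noncolliding n A"
  then have A: "A \<subseteq> {S. serpent (L n) S}" and nc: "noncolliding n A" by simp_all
  note match = nc[unfolded noncolliding_def]
  have "S = T" if ST: "S \<in> A" "T \<in> A" and S: "q \<in> S \<and> e \<in> serpent_sides (L n) S q"
    and T: "q \<in> T \<and> e \<in> serpent_sides (L n) T q" for S T q e
  proof -
    have "\<exists>j c. site n j c \<and> q = square n j c"
      using n A ST(1)
    proof (cases rule: serpentE)
      case (1 i a b) then show ?thesis using S unfolding link_def linked_def by blast
    next
      case (2 i) then show ?thesis using S unfolding stub_def stubbed_def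
          by (auto intro: site_string)
    qed
    then obtain j c where q: "site n j c" "q = square n j c" by blast
    have ll: "link n i a b = link n k a' b'" if l: "linked n A i a b" "linked n A k a' b'"
      and "q \<in> link n i a b \<and> e \<in> serpent_sides (L n) (link n i a b) q"
      and "q \<in> link n k a' b' \<and> e \<in> serpent_sides (L n) (link n k a' b') q" for i a b k a' b'
    proof -
      have s: "site n i a" "site n (Suc i) b" "site n k a'" "site n (Suc k) b'"
        using l by (auto simp: linked_def)
      have 1: "e = exit_side n j c i" "j = i \<and> c = a \<or> j = Suc i \<and> c = b"
        using that(3) unfolding q(2) link_stop_iff[OF n s(1,2) q(1)] by simp_all
      have 2: "e = exit_side n j c k" "j = k \<and> c = a' \<or> j = Suc k \<and> c = b'"
        using that(4) unfolding q(2) link_stop_iff[OF n s(3,4) q(1)] by simp_all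
      show ?thesis
      proof (cases c)
        case True
        then show ?thesis using 1(2) 2(2) match l by (elim disjE) (clarsimp, metis)+
      next
        case False
        moreover have "i < n" "k < n" using s by (auto simp: site_def)
        ultimately have "i = k" using 1(1) 2(1) gate_eq_iff[OF n] by (simp add: exit_side_def)
        then show ?thesis using 1(2) 2(2) match l by (elim disjE) (clarsimp, metis)+
      qed
    qed
    have ls: False if l: "linked n A i a b" "stubbed n A k"
      and "q \<in> link n i a b \<and> e \<in> serpent_sides (L n) (link n i a b) q"
      and "q \<in> stub n k \<and> e \<in> serpent_sides (L n) (stub n k) q" for i a b k
    proof -
      have s: "site n i a" "site n (Suc i) b" "site n k True"
        using l by (auto simp: linked_def stubbed_def)
      have 1: "e = exit_side n j c i" "j = i \<and> c = a \<or> j = Suc i \<and> c = b"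
        using that(3) unfolding q(2) link_stop_iff[OF n s(1,2) q(1)] by simp_all
      have 2: "e = hatch n k" "j = k"
        using that(4) unfolding q(2) stub_stop_iff[OF n s(3) q(1)] by simp_all
      have "i < n" "k < n" using s by (auto simp: site_def)
      then have c using 1(1) 2(1) gate_neq_hatch[OF n]
          by (auto simp: exit_side_def split: if_splits)
      then show False using 1(2) 2(2) match l by (elim disjE) (clarsimp, metis)+
    qed
    have ss: "stub n i = stub n k" if l: "stubbed n A i" "stubbed n A k"
      and "q \<in> stub n i \<and> e \<in> serpent_sides (L n) (stub n i) q"
      and "q \<in> stub n k \<and> e \<in> serpent_sides (L n) (stub n k) q" for i k
    proof -
      have s: "site n i True" "site n k True" using l by (auto simp: stubbed_def)
      show ?thesis using that(3,4) unfolding q(2) stub_stop_iff[OF n s(1) q(1)]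
          stub_stop_iff[OF n s(2) q(1)]
        by simp
    qed
    from n A ST(1) show "S = T"
    proof (cases rule: serpentE)
      case S': (1 i a b)
      from n A ST(2) show ?thesis
      proof (cases rule: serpentE)
        case 1 then show ?thesis using ll S S' T by blast
      next
        case 2 then show ?thesis using ls S S' T by blast
      qed
    next
      case S': (2 i)
      from n A ST(2) show ?thesis
      proof (cases rule: serpentE)
        case 1 then show ?thesis using ls S S' T by blast
      next
        case 2 then show ?thesis using ss S S' T by blast
      qed
    qed
  qed
  then show "A \<in> compatible_sets (L n)" unfolding compatible_sets_def using A by blast
qed

section \<open>Patterns of serpents\<close>

definition departs :: "nat \<Rightarrow> nat set set set \<Rightarrow> nat \<Rightarrow> bool \<Rightarrow> bool" where
  "departs n A i a \<longleftrightarrow> (\<exists>b. linked n A i a b)"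

definition arrives :: "nat \<Rightarrow> nat set set set \<Rightarrow> nat \<Rightarrow> bool \<Rightarrow> bool" where
  "arrives n A i b \<longleftrightarrow> (\<exists>a. linked n A i a b)"

lemma card_eq_of_bool:
  assumes "\<And>x y. x \<in> X \<Longrightarrow> y \<in> X \<Longrightarrow> x = y"
  shows "card X = of_bool (\<exists>x. x \<in> X)"
proof (cases "X = {}")
  case False
  then obtain x where "x \<in> X" by blast
  then have "X = {x}" using assms by blast
  then show ?thesis by simp
qed simp

text \<open>By compatibility the number of segments is \<open>0\<close> or \<open>1\<close>, so only existence matters.\<close>

lemma stops_L:
  assumes n: "1 \<le> n" and A: "A \<in> compatible_sets (L n)" and q: "site n j c"
  shows "stops (L n) A (square n j c) e = of_bool
    (e = exit_side n j c j \<and> departs n A j c \<or>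
     (\<exists>i. j = Suc i \<and> e = exit_side n j c i \<and> arrives n A i c) \<or>
     e = hatch n j \<and> stubbed n A j)"
proof -
  have sub: "A \<subseteq> {S. serpent (L n) S}" using A by (simp add: compatible_sets_def)
  let ?P = "\<lambda>S. square n j c \<in> S \<and> e \<in> serpent_sides (L n) S (square n j c)"
  have link: "linked n A i a b \<and> ?P (link n i a b) \<longleftrightarrow>
      linked n A i a b \<and> e = exit_side n j c i \<and> (j = i \<and> c = a \<or> j = Suc i \<and> c = b)" for i a b
    using link_stop_iff[OF n _ _ q] unfolding linked_def by blast
  have stub: "stubbed n A i \<and> ?P (stub n i) \<longleftrightarrow> stubbed n A i \<and> e = hatch n i \<and> j = i" for i
    using stub_stop_iff[OF n _ q] unfolding stubbed_def by blast
  have "stops (L n) A (square n j c) e = of_bool (\<exists>S. S \<in> {S \<in> A. ?P S})"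
    unfolding stops_def by (rule card_eq_of_bool) (use compatibleD[OF A] in blast)
  also have "(\<exists>S. S \<in> {S \<in> A. ?P S}) \<longleftrightarrow> (\<exists>S\<in>A. ?P S)" by blast
  also have "\<dots> \<longleftrightarrow> (\<exists>i a b. linked n A i a b \<and> e = exit_side n j c i \<and> (j = i \<and> c = a \<or> j = Suc i
      \<and> c = b)) \<or>
      (\<exists>i. stubbed n A i \<and> e = hatch n i \<and> j = i)"
    unfolding ex_serpent_iff[OF n sub] link stub by (rule refl)
  also have "\<dots> \<longleftrightarrow> (e = exit_side n j c j \<and> departs n A j c \<or>
     (\<exists>i. j = Suc i \<and> e = exit_side n j c i \<and> arrives n A i c) \<or>
     e = hatch n j \<and> stubbed n A j)"
    unfolding departs_def arrives_def by blast
  finally show ?thesis .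
qed

text \<open>Separates the links over \<open>gate n j\<close> from those over the preceding gate in the statements about column \<open>j\<close>.\<close>

lemma ex_end_iff: "(\<exists>i a b. R i a b \<and> E i \<and> (j = i \<and> a \<or> j = Suc i \<and> b)) \<longleftrightarrow>
      E j \<and> (\<exists>b. R j True b) \<or> (\<exists>i. j = Suc i \<and> E i \<and> (\<exists>a. R i a True))" (is "?l \<longleftrightarrow> ?r")
proof
  assume ?l
  then obtain i a b where r: "R i a b" "E i" "j = i \<and> a \<or> j = Suc i \<and> b"
      by (elim exE conjE) (rule that)
  from r(3) show ?r
  proof
    assume "j = i \<and> a"
    then have "E j \<and> R j True b" using r(1,2) by simp
    then show ?r by (intro disjI1) auto
  next
    assume "j = Suc i \<and> b"
    then have "j = Suc i \<and> E i \<and> R i a True" using r(1,2) by simp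
    then show ?r by (intro disjI2) auto
  qed
next
  assume ?r
  then show ?l
  proof (elim disjE exE conjE)
    fix b assume "E j" "R j True b"
    then show ?l by (intro exI[of _ j] exI[of _ True] exI[of _ b]) simp
  next
    fix i a assume "j = Suc i" "E i" "R i a True"
    then show ?l by (intro exI[of _ i] exI[of _ a] exI[of _ True]) simp
  qed
qed

text \<open>A serpent that turns in a square of the string does so on its way from or to the extra square below, and
at most one serpent ends in that extra square, so again the number is at most \<open>1\<close>.\<close>

lemma turns_L:
  assumes n: "1 \<le> n" and A: "A \<in> compatible_sets (L n)" and q: "site n j c" and ef: "e \<noteq> f"
  shows "turns (L n) A (square n j c) e f = of_bool (\<not> c \<and>
    ({e, f} = {gate n j, hatch n j} \<and> departs n A j True \<or>
     (\<exists>i. j = Suc i \<and> {e, f} = {gate n i, hatch n j} \<and> arrives n A i True)))"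
proof -
  have sub: "A \<subseteq> {S. serpent (L n) S}" and nc: "noncolliding n A"
    using A compatible_L_iff[OF n] by auto
  let ?P = "\<lambda>S. e \<in> serpent_sides (L n) S (square n j c) \<and> f \<in> serpent_sides (L n) S (square n j c)"
  have link: "linked n A i a b \<and> ?P (link n i a b) \<longleftrightarrow>
      linked n A i a b \<and> \<not> c \<and> {e, f} = {gate n i, hatch n j} \<and> (j = i \<and> a \<or> j = Suc i \<and> b)"
          for i a b
    using link_turn_iff[OF n _ _ q ef, of i a b] unfolding linked_def by (simp cong: conj_cong)
  have stub: "\<not> (stubbed n A i \<and> ?P (stub n i))" for i
  proof
    assume "stubbed n A i \<and> ?P (stub n i)"
    then show False using stub_turn[OF n _ ef, of i "square n j c"] unfolding stubbed_def by simp
  qed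
  have no_stub: "(\<exists>i. stubbed n A i \<and> ?P (stub n i)) = False" using stub by simp
  have turnE: "\<exists>i a b. S = link n i a b \<and> linked n A i a b \<and> {e, f} = {gate n i, hatch n j} \<and> (j
      = i \<and> a \<or> j = Suc i \<and> b)"
    if "S \<in> A" "?P S" for S
    using n sub that(1)
  proof (cases rule: serpentE)
    case (1 i a b)
    then have "\<not> c \<and> {e, f} = {gate n i, hatch n j} \<and> (j = i \<and> a \<or> j = Suc i \<and> b)"
      using link[of i a b] that(2) by simp
    then show ?thesis using 1 by (intro exI[of _ i] exI[of _ a] exI[of _ b]) simp
  next
    case (2 i)
    then show ?thesis using stub[of i] that(2) by simp
  qed
  have "S = T" if ST: "S \<in> A" "?P S" "T \<in> A" "?P T" for S T
  proof -
    obtain i a b where S: "S = link n i a b" "linked n A i a b" "{e, f} = {gate n i, hatch n j}"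
        "j = i \<and> a \<or> j = Suc i \<and> b"
      using turnE[OF ST(1,2)] by (elim exE conjE) (rule that)
    obtain k a' b' where T: "T = link n k a' b'" "linked n A k a' b'" "{e, f}
        = {gate n k, hatch n j}" "j = k \<and> a' \<or> j = Suc k \<and> b'"
      using turnE[OF ST(3,4)] by (elim exE conjE) (rule that)
    have s: "site n i a" "site n (Suc i) b" "site n k a'" "site n (Suc k) b'"
      using S(2) T(2) by (auto simp: linked_def)
    then have i: "i < n" "k < n" by (auto simp: site_def)
    have "{gate n i, hatch n j} = {gate n k, hatch n j}" using S(3) T(3) by simp
    then have "gate n i = gate n k" by (metis doubleton_eq_iff)
    then have "i = k" using gate_eq_iff[OF n i] by simp
    moreover have "\<not> j = i" if "j = Suc k" using that \<open>i = k\<close> by simp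
    moreover have "\<not> j = k" if "j = Suc i" using that \<open>i = k\<close> by simp
    ultimately have "a = a' \<and> b = b'"
      using S(2,4) T(2,4) nc unfolding noncolliding_def by metis
    then show ?thesis using S(1) T(1) \<open>i = k\<close> by simp
  qed
  then have "x = y" if "x \<in> {S \<in> A. ?P S}" "y \<in> {S \<in> A. ?P S}" for x y
    using that by simp
  then have "turns (L n) A (square n j c) e f = of_bool (\<exists>S. S \<in> {S \<in> A. ?P S})"
    unfolding turns_def by (rule card_eq_of_bool)
  also have "(\<exists>S. S \<in> {S \<in> A. ?P S}) \<longleftrightarrow> (\<exists>S\<in>A. ?P S)" by blast
  also have "\<dots> \<longleftrightarrow> (\<exists>i a b. linked n A i a b \<and> \<not> c \<and> {e, f} = {gate n i, hatch n j} \<and> (j = i \<and> a \<or> j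
      = Suc i \<and> b))"
    unfolding ex_serpent_iff[OF n sub] link no_stub by simp
  also have "\<dots> \<longleftrightarrow> \<not> c \<and> (\<exists>i a b. linked n A i a b \<and> {e, f} = {gate n i, hatch n j} \<and> (j = i \<and> a \<or> j
      = Suc i \<and> b))"
    by (cases c) simp_all
  also have "\<dots> \<longleftrightarrow> \<not> c \<and>
    ({e, f} = {gate n j, hatch n j} \<and> departs n A j True \<or>
     (\<exists>i. j = Suc i \<and> {e, f} = {gate n i, hatch n j} \<and> arrives n A i True))"
    unfolding departs_def arrives_def
      ex_end_iff[of "linked n A" "\<lambda>i. {e, f} = {gate n i, hatch n j}"] by (rule refl)
  finally show ?thesis .
qed


lemma gate_side:
  assumes "1 \<le> n" "i < n"
  shows "gate n i \<in> sides (square n i False)" "gate n i \<in> sides (square n (Suc i) False)"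
  using joins_imp_adjacent[OF assms(1)] joins_gate_iff[OF assms] by blast+

lemma hatch_side:
  assumes "1 \<le> n" "site n i True"
  shows "hatch n i \<in> sides (square n i False)"
  using joins_imp_adjacent[OF assms(1)] joins_hatch_iff[OF assms(1), of i] assms(2)
  unfolding site_def by blast

lemma doubleton_right_cancel: "{x, z} = {y, z} \<longleftrightarrow> x = y"
  by (metis doubleton_eq_iff)

lemma departs_site: "departs n A i c \<Longrightarrow> i < n \<and> site n i c"
  by (auto simp: departs_def linked_def site_def)

lemma arrives_site: "arrives n A i c \<Longrightarrow> i < n \<and> site n (Suc i) c"
  by (auto simp: arrives_def linked_def site_def)

lemma stubbed_site: "stubbed n A i \<Longrightarrow> site n i True"
  by (simp add: stubbed_def)

context
  fixes n A
  assumes n: "1 \<le> n" and A: "A \<in> compatible_sets (L n)"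
begin

lemma departs_string_iff_stops:
  assumes i: "i < n"
  shows "departs n A i False \<longleftrightarrow> stops (L n) A (square n i False) (gate n i) = 1"
proof -
  have "site n i False" using i by (simp add: site_def)
  moreover have "\<not> (i = Suc k \<and> gate n i = gate n k)" for k
    using gate_eq_iff[OF n i, of k] i by auto
  moreover have "\<not> gate n i = hatch n i" using gate_neq_hatch[OF n i i] by simp
  ultimately show ?thesis by (cases i) (simp_all add: stops_L[OF n A] exit_side_def)
qed

lemma arrives_string_iff_stops:
  assumes i: "i < n"
  shows "arrives n A i False \<longleftrightarrow> stops (L n) A (square n (Suc i) False) (gate n i) = 1"
proof -
  have "site n (Suc i) False" using i by (simp add: site_def)
  moreover have "\<not> (gate n i = gate n (Suc i) \<and> departs n A (Suc i) False)"
    using gate_eq_iff[OF n i, of "Suc i"] departs_site[of n A "Suc i" False] by auto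
  moreover have "\<not> (gate n i = hatch n (Suc i) \<and> stubbed n A (Suc i))"
    using gate_neq_hatch(1)[OF n i, of "Suc i"] stubbed_site unfolding site_def by blast
  ultimately show ?thesis by (simp add: stops_L[OF n A] exit_side_def)
qed

lemma stubbed_iff_stops:
  assumes i: "site n i True"
  shows "stubbed n A i \<longleftrightarrow> stops (L n) A (square n i False) (hatch n i) = 1"
proof -
  have "i < n" using i by (simp add: site_def)
  moreover have "hatch n i \<noteq> gate n i" using gate_neq_hatch[OF n] \<open>i < n\<close> by simp
  moreover have "\<not> (i = Suc k \<and> hatch n i = gate n k)" for k
    using gate_neq_hatch(2)[OF n, of k i] \<open>i < n\<close> by auto
  ultimately show ?thesis
    unfolding stops_L[OF n A site_string[OF i]] exit_side_def by (cases i) simp_all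
qed

lemma departs_extra_iff_turns:
  assumes i: "site n i True"
  shows "departs n A i True \<longleftrightarrow> turns (L n) A (square n i False) (gate n i) (hatch n i) = 1"
proof -
  have "i < n" using i by (simp add: site_def)
  moreover have "gate n i \<noteq> hatch n i" using gate_neq_hatch[OF n] \<open>i < n\<close> by simp
  moreover have "\<not> (i = Suc k \<and> gate n i = gate n k)" for k
    using gate_eq_iff[OF n \<open>i < n\<close>, of k] \<open>i < n\<close> by auto
  ultimately show ?thesis
    unfolding turns_L[OF n A site_string[OF i] \<open>gate n i \<noteq> hatch n i\<close>] doubleton_right_cancel
    by (cases i) simp_all
qed

lemma arrives_extra_iff_turns:
  assumes i: "site n (Suc i) True"
  shows "arrives n A i True \<longleftrightarrow> turns (L n) A (square n (Suc i) False) (gate n i) (hatch n (Suc i))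
      = 1"
proof -
  have "Suc i < n" using i by (simp add: site_def)
  moreover have "gate n i \<noteq> hatch n (Suc i)" using gate_neq_hatch[OF n] \<open>Suc i < n\<close> by simp
  moreover have "gate n i \<noteq> gate n (Suc i)"
    using gate_eq_iff[OF n, of i "Suc i"] \<open>Suc i < n\<close> by simp
  ultimately show ?thesis
    by (simp add: turns_L[OF n A site_string[OF i]] doubleton_right_cancel)
qed

end

lemma not_opposite_gate_hatch:
  "\<not> opposite (gate n i) (hatch n i)" "\<not> opposite (gate n i) (hatch n (Suc i))"
  by (auto simp: opposite_def gate_def hatch_def)

text \<open>The stops in the string show the extremities there, and the turns show the links that end in extra
squares, separately for the gates on the left and on the right. How the extremities on the two sides of
a gate are paired does not show up.\<close>

lemma same_pattern_L_iff:
  assumes n: "1 \<le> n" and A: "A \<in> compatible_sets (L n)" and B: "B \<in> compatible_sets (L n)"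
  shows "(A, B) \<in> same_pattern (L n) \<longleftrightarrow>
    departs n A = departs n B \<and> arrives n A = arrives n B \<and> stubbed n A = stubbed n B"
proof
  assume "(A, B) \<in> same_pattern (L n)"
  then have pat: "\<forall>q\<in>squares (L n).
        (\<forall>e\<in>sides q. stops (L n) A q e = stops (L n) B q e) \<and>
        (\<forall>e\<in>sides q. \<forall>f\<in>sides q. e \<noteq> f \<and> \<not> opposite e f \<longrightarrow>
           turns (L n) A q e f = turns (L n) B q e f)"
    unfolding same_pattern_def by simp
  have sq: "square n j c \<in> squares (L n)" if "site n j c" for j c
    using that squares_L_sites[OF n] by blast
  have st: "stops (L n) A (square n j c) e = stops (L n) B (square n j c) e"
    if "site n j c" "e \<in> sides (square n j c)" for j c e
    using bspec[OF conjunct1[OF bspec[OF pat sq[OF that(1)]]] that(2)] .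
  have tu: "turns (L n) A (square n j c) e f = turns (L n) B (square n j c) e f"
    if "site n j c" "e \<in> sides (square n j c)" "f \<in> sides (square n j c)" "e \<noteq> f" "\<not> opposite e f"
        for j c e f
    using bspec[OF bspec[OF conjunct2[OF bspec[OF pat sq[OF that(1)]]] that(2)] that(3)] that(4,5)
    by blast
  have dep: "departs n A i c = departs n B i c" for i c
  proof (cases "i < n \<and> site n i c")
    case False
    then have "\<not> departs n A i c" "\<not> departs n B i c" using departs_site by metis+
    then show ?thesis by simp
  next
    case True
    then have i: "i < n" and s: "site n i False" by (auto intro: site_string)
    show ?thesis
    proof (cases c)
      case False
      then show ?thesis
        using departs_string_iff_stops[OF n A i] departs_string_iff_stops[OF n B i]
            st[OF s gate_side(1)[OF n i]]
        by simp
    next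
      case c: True
      then have t: "site n i True" using True by simp
      show ?thesis
        using departs_extra_iff_turns[OF n A t] departs_extra_iff_turns[OF n B t] c
          tu[OF s gate_side(1)[OF n i] hatch_side[OF n t] gate_neq_hatch(1)[OF n i i]
            not_opposite_gate_hatch(1)]
        by simp
    qed
  qed
  have arr: "arrives n A i c = arrives n B i c" for i c
  proof (cases "i < n \<and> site n (Suc i) c")
    case False
    then have "\<not> arrives n A i c" "\<not> arrives n B i c" using arrives_site by metis+
    then show ?thesis by simp
  next
    case True
    then have i: "i < n" and s: "site n (Suc i) False" by (auto intro: site_string)
    show ?thesis
    proof (cases c)
      case False
      then show ?thesis
        using arrives_string_iff_stops[OF n A i] arrives_string_iff_stops[OF n B i]
            st[OF s gate_side(2)[OF n i]]
        by simp
    next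
      case c: True
      then have t: "site n (Suc i) True" using True by simp
      then have "Suc i < n" by (simp add: site_def)
      then show ?thesis
        using arrives_extra_iff_turns[OF n A t] arrives_extra_iff_turns[OF n B t] c
          tu[OF s gate_side(2)[OF n i] hatch_side[OF n t] gate_neq_hatch(1)[OF n i]
            not_opposite_gate_hatch(2)]
        by simp
    qed
  qed
  have "stubbed n A i = stubbed n B i" for i
  proof (cases "site n i True")
    case False
    then have "\<not> stubbed n A i" "\<not> stubbed n B i" using stubbed_site by metis+
    then show ?thesis by simp
  next
    case True
    show ?thesis
      using stubbed_iff_stops[OF n A True] stubbed_iff_stops[OF n B True]
        st[OF site_string[OF True] hatch_side[OF n True]] by simp
  qed
  then show "departs n A = departs n B \<and> arrives n A = arrives n B \<and> stubbed n A = stubbed n B"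
    using dep arr by (intro conjI ext)
next
  assume eq: "departs n A = departs n B \<and> arrives n A = arrives n B \<and> stubbed n A = stubbed n B"
  have "stops (L n) A q e = stops (L n) B q e" if sq: "q \<in> squares (L n)" for q e
  proof -
    obtain j c where s: "site n j c" and q: "q = square n j c"
      using sq unfolding squares_L_sites[OF n] by blast
    show ?thesis unfolding q stops_L[OF n A s] stops_L[OF n B s] using eq by simp
  qed
  moreover have "turns (L n) A q e f = turns (L n) B q e f" if sq: "q \<in> squares (L n)" and ef:
      "e \<noteq> f" for q e f
  proof -
    obtain j c where s: "site n j c" and q: "q = square n j c"
      using sq unfolding squares_L_sites[OF n] by blast
    show ?thesis unfolding q turns_L[OF n A s ef] turns_L[OF n B s ef] using eq by simp
  qed
  ultimately show "(A, B) \<in> same_pattern (L n)" unfolding same_pattern_def using A B by simp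
qed


section \<open>Nests as words\<close>

text \<open>One letter \<open>(v, p, q, r, s)\<close> for each gate: \<open>v\<close> tells whether there is a stub in the column left of the
gate, \<open>p\<close> and \<open>q\<close> whether a link over the gate ends in the string square and in the extra square on its
left, and \<open>r\<close> and \<open>s\<close> the same on its right.\<close>

type_synonym letter = "bool \<times> bool \<times> bool \<times> bool \<times> bool"

definition letter :: "nat \<Rightarrow> nat set set set \<Rightarrow> nat \<Rightarrow> letter" where
  "letter n A i = (stubbed n A i, departs n A i False, departs n A i True,
     arrives n A i False, arrives n A i True)"

text \<open>The flag \<open>b\<close> says that the extra square left of the gate is taken by a link over the preceding gate. The
last clause is the condition for a partial matching between the chosen squares on both sides.\<close>

fun legal :: "bool \<Rightarrow> letter \<Rightarrow> bool" where
  "legal b (v, p, q, r, s) \<longleftrightarrow> \<not> (b \<and> v) \<and> \<not> (b \<and> q) \<and> \<not> (v \<and> q) \<and>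
     of_bool p + of_bool q = (of_bool r + of_bool s :: nat)"

fun enters_extra :: "letter \<Rightarrow> bool" where
  "enters_extra (v, p, q, r, s) = s"

fun weight :: "letter \<Rightarrow> nat" where
  "weight (v, p, q, r, s) = of_bool v + of_bool p + of_bool q"

text \<open>The last column has no extra square, so the walk has to end with the flag \<open>False\<close>; in the first column,
where the extra square is missing as well, it will start with \<open>True\<close>.\<close>

fun walk :: "bool \<Rightarrow> letter list \<Rightarrow> bool" where
  "walk b [] \<longleftrightarrow> \<not> b"
| "walk b (l # w) \<longleftrightarrow> legal b l \<and> walk (enters_extra l) w"

lemma walk_iff_nth:
  "walk b w \<longleftrightarrow> (\<forall>i<length w. legal ((b # map enters_extra w) ! i) (w ! i)) \<and>
     \<not> last (b # map enters_extra w)"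
proof (induction w arbitrary: b)
  case (Cons l w)
  have "(\<forall>i<length (l # w). legal ((b # map enters_extra (l # w)) ! i) ((l # w) ! i)) \<longleftrightarrow>
      legal b l \<and> (\<forall>i<length w. legal ((enters_extra l # map enters_extra w) ! i) (w ! i))"
    by (simp add: All_less_Suc2)
  then show ?case using Cons.IH[of "enters_extra l"] by simp
qed simp

definition word :: "nat \<Rightarrow> nat set set set \<Rightarrow> letter list" where
  "word n A = map (letter n A) [0..<n]"

definition words :: "bool \<Rightarrow> nat \<Rightarrow> letter list set" where
  "words b n = {w. length w = n \<and> walk b w}"

lemma word_eq_iff:
  "word n A = word n B \<longleftrightarrow>
    departs n A = departs n B \<and> arrives n A = arrives n B \<and> stubbed n A = stubbed n B"
proof
  assume eq: "word n A = word n B"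
  have l: "letter n A i = letter n B i" if "i < n" for i
    using arg_cong[OF eq, of "\<lambda>w. w ! i"] that by (simp add: word_def)
  have "departs n A i c = departs n B i c" for i c
    using l[of i] departs_site[of n A i c] departs_site[of n B i c]
    by (cases "i < n"; cases c) (auto simp: letter_def)
  moreover have "arrives n A i c = arrives n B i c" for i c
    using l[of i] arrives_site[of n A i c] arrives_site[of n B i c]
    by (cases "i < n"; cases c) (auto simp: letter_def)
  moreover have "stubbed n A i = stubbed n B i" for i
    using l[of i] stubbed_site[of n A i] stubbed_site[of n B i]
    by (cases "i < n") (auto simp: letter_def site_def)
  ultimately show "departs n A = departs n B \<and> arrives n A = arrives n B \<and> stubbed n A
      = stubbed n B"
    by (intro conjI ext)
qed (simp add: word_def letter_def)

text \<open>Both sides count the edges of the matching \<open>M\<close>.\<close>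

lemma matching_degrees:
  assumes "\<And>a b c. M a b \<Longrightarrow> M a c \<Longrightarrow> b = c" "\<And>a b c. M a b \<Longrightarrow> M c b \<Longrightarrow> a = c"
  shows "of_bool (\<exists>b. M False b) + of_bool (\<exists>b. M True b) =
    (of_bool (\<exists>a. M a False) + of_bool (\<exists>a. M a True) :: nat)"
proof -
  have "\<not> (M False False \<and> M False True)" "\<not> (M True False \<and> M True True)"
    "\<not> (M False False \<and> M True False)" "\<not> (M False True \<and> M True True)"
    using assms by blast+
  then show ?thesis unfolding ex_bool_eq
    by (cases "M False False"; cases "M False True"; cases "M True False"; cases
        "M True True") simp_all
qed

lemma word_in_words:
  assumes n: "1 \<le> n" and A: "A \<in> compatible_sets (L n)"
  shows "word n A \<in> words True n"
proof -
  have nc: "noncolliding n A" using A compatible_L_iff[OF n] by simp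
  have degrees: "of_bool (departs n A i False) + of_bool (departs n A i True) =
      (of_bool (arrives n A i False) + of_bool (arrives n A i True) :: nat)" for i
    unfolding departs_def arrives_def
    by (rule matching_degrees) (use nc in \<open>unfold noncolliding_def, blast+\<close>)
  have excl: "\<not> (stubbed n A i \<and> departs n A i True)" for i
    using nc unfolding noncolliding_def departs_def by blast
  have "legal ((True # map enters_extra (word n A)) ! i) (word n A ! i)" if i: "i < n" for i
  proof (cases i)
    case 0
    have "\<not> stubbed n A 0" "\<not> departs n A 0 True"
      using stubbed_site[of n A 0] departs_site[of n A 0 True] by (auto simp: site_def)
    then show ?thesis using i 0 degrees[of 0] by (simp add: word_def letter_def)
  next
    case (Suc k)
    have "\<not> (arrives n A k True \<and> stubbed n A i)" "\<not> (arrives n A k True \<and> departs n A i True)"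
      using nc unfolding noncolliding_def departs_def arrives_def Suc by blast+
    then show ?thesis using i Suc degrees[of i] excl[of i] by (simp add: word_def letter_def)
  qed
  moreover have "\<not> last (True # map enters_extra (word n A))"
  proof -
    have "\<not> arrives n A (n - 1) True" using arrives_site[of n A "n - 1" True] n
        by (auto simp: site_def)
    then show ?thesis using n by (simp add: word_def letter_def last_map)
  qed
  moreover have "length (word n A) = n" by (simp add: word_def)
  ultimately show ?thesis unfolding words_def walk_iff_nth mem_Collect_eq by presburger
qed

text \<open>Two links over a gate could be parallel or crossing, with the same pattern; the parallel ones are chosen.\<close>

fun joined :: "letter \<Rightarrow> bool \<Rightarrow> bool \<Rightarrow> bool" where
  "joined (v, p, q, r, s) a b \<longleftrightarrow> (if a then q else p) \<and> (if b then s else r) \<and> (p \<and> q \<longrightarrow> a = b)"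

definition realize :: "nat \<Rightarrow> letter list \<Rightarrow> nat set set set" where
  "realize n w = {link n i a b | i a b. i < n \<and> joined (w ! i) a b} \<union> {stub n i | i. i < n
      \<and> fst (w ! i)}"

lemma joined_degrees:
  assumes "legal b (v, p, q, r, s)"
  shows "(\<exists>y. joined (v, p, q, r, s) False y) = p" "(\<exists>y. joined (v, p, q, r, s) True y) = q"
    "(\<exists>x. joined (v, p, q, r, s) x False) = r" "(\<exists>x. joined (v, p, q, r, s) x True) = s"
  using assms unfolding ex_bool_eq by (cases p; cases q; cases r; cases s; simp)+

lemma joined_matching:
  assumes "legal b l"
  shows "joined l x y \<Longrightarrow> joined l x y' \<Longrightarrow> y = y'" "joined l x y \<Longrightarrow> joined l x' y \<Longrightarrow> x = x'"
proof -
  obtain v p q r s where l: "l = (v, p, q, r, s)" by (rule prod_cases5)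
  note leg = assms[unfolded l]
  show "y = y'" if "joined l x y" "joined l x y'"
    using that leg unfolding l by (cases p; cases q; cases r; cases s; simp split: if_splits)
  show "x = x'" if "joined l x y" "joined l x' y"
    using that leg unfolding l by (cases p; cases q; cases r; cases s; simp split: if_splits)
qed

lemma legal_after_extra:
  assumes "legal True l"
  shows "\<not> fst l" "\<not> joined l True b"
proof -
  obtain v p q r s where l: "l = (v, p, q, r, s)" by (rule prod_cases5)
  have "\<not> v" "\<not> q" using assms unfolding l legal.simps by blast+
  then show "\<not> fst l" "\<not> joined l True b" unfolding l joined.simps fst_conv if_True by blast+
qed

lemma legal_excludes:
  assumes "legal b l"
  shows "\<not> (fst l \<and> joined l True y)"
proof -
  obtain v p q r s where l: "l = (v, p, q, r, s)" by (rule prod_cases5)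
  have "\<not> (v \<and> q)" using assms unfolding l legal.simps by blast
  then show ?thesis unfolding l joined.simps fst_conv if_True by blast
qed

lemma joined_enters_extra:
  assumes "joined l a True"
  shows "enters_extra l"
proof -
  obtain v p q r s where l: "l = (v, p, q, r, s)" by (rule prod_cases5)
  show ?thesis using assms unfolding l joined.simps enters_extra.simps if_True by (elim conjE)
qed

text \<open>The legality of the letters is exactly what makes the chosen serpents exist and be compatible: links to
extra squares that do not exist are excluded by the initial and final flags.\<close>

lemma words_realized:
  assumes n: "1 \<le> n" and w: "w \<in> words True n"
  shows "realize n w \<in> compatible_sets (L n) \<and> word n (realize n w) = w"
proof -
  let ?A = "realize n w"
  have len: "length w = n" and walk: "walk True w" using w by (auto simp: words_def)
  have leg: "legal ((True # map enters_extra w) ! i) (w ! i)" if "i < n" for i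
    using walk that len unfolding walk_iff_nth by blast
  have end_string: "\<not> enters_extra (w ! (n - 1))"
  proof -
    have "last (True # map enters_extra w) = enters_extra (w ! (n - 1))"
      using n len by (cases w rule: rev_cases) (auto simp: nth_append)
    then show ?thesis using walk unfolding walk_iff_nth by simp
  qed
  have prev: "(True # map enters_extra w) ! Suc i = enters_extra (w ! i)" if "Suc i < n" for i
    using that len by simp
  note start = legal_after_extra[OF leg[of 0, unfolded nth_Cons_0]]
  have step: "\<not> fst (w ! Suc i)" "\<not> joined (w ! Suc i) True b" if "Suc i < n"
      "enters_extra (w ! i)" for i b
    using legal_after_extra[of "w ! Suc i"] leg[OF that(1)] unfolding prev[OF that(1)]
        by (simp_all add: that(2))
  have s1: "site n i a \<and> site n (Suc i) b" if "i < n" "joined (w ! i) a b" for i a b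
  proof -
    have "0 < i" if a
    proof (rule ccontr)
      assume "\<not> 0 < i"
      then show False using start(2)[of b] n \<open>joined (w ! i) a b\<close> that by simp
    qed
    moreover have "Suc i < n" if b
    proof (rule ccontr)
      assume "\<not> Suc i < n"
      then have "i = n - 1" using \<open>i < n\<close> by simp
      then show False
        using joined_enters_extra[of "w ! i" a] \<open>joined (w ! i) a b\<close> that end_string by simp
    qed
    ultimately show ?thesis using \<open>i < n\<close> by (auto simp: site_def)
  qed
  have s2: "site n i True" if "i < n" "fst (w ! i)" for i
  proof -
    have "i \<noteq> 0"
    proof
      assume "i = 0"
      then show False using start(1) n that(2) by simp
    qed
    then show ?thesis using that(1) by (simp add: site_def)
  qed
  have linked: "linked n ?A i a b \<longleftrightarrow> i < n \<and> joined (w ! i) a b" for i a b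
  proof
    assume l: "linked n ?A i a b"
    then have s: "site n i a" "site n (Suc i) b" and "link n i a b \<in> ?A" by (auto simp: linked_def)
    then consider j c d where "link n i a b = link n j c d" "j < n" "joined (w ! j) c d"
      | j where "link n i a b = stub n j" "j < n" "fst (w ! j)"
      unfolding realize_def by blast
    then show "i < n \<and> joined (w ! i) a b"
    proof cases
      case 1
      then show ?thesis using link_eq_iff[OF n s] s1[OF 1(2,3)] by simp
    next
      case 2
      then show ?thesis using link_neq_stub[OF n s s2[OF 2(2,3)]] by simp
    qed
  next
    assume "i < n \<and> joined (w ! i) a b"
    then show "linked n ?A i a b" using s1 unfolding linked_def realize_def by blast
  qed
  have stubbed: "stubbed n ?A i \<longleftrightarrow> i < n \<and> fst (w ! i)" for i
  proof
    assume l: "stubbed n ?A i"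
    then have s: "site n i True" and "stub n i \<in> ?A" by (auto simp: stubbed_def)
    then consider j c d where "stub n i = link n j c d" "j < n" "joined (w ! j) c d"
      | j where "stub n i = stub n j" "j < n" "fst (w ! j)"
      unfolding realize_def by blast
    then show "i < n \<and> fst (w ! i)"
    proof cases
      case 1
      then show ?thesis using link_neq_stub[OF n _ _ s, of j c d] s1[OF 1(2,3)] by simp
    next
      case 2
      then show ?thesis using stub_eq_iff[OF n s s2[OF 2(2,3)]] by simp
    qed
  next
    assume "i < n \<and> fst (w ! i)"
    then show "stubbed n ?A i" using s2 unfolding stubbed_def realize_def by blast
  qed
  note deg = joined_matching[OF leg]
  have "noncolliding n ?A"
    unfolding noncolliding_def linked stubbed
  proof (intro conjI allI)
    show "(i < n \<and> joined (w ! i) a b) \<and> i < n \<and> joined (w ! i) a c \<longrightarrow> b = c" for i a b c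
      using deg(1)[of i a b c] by simp
    show "(i < n \<and> joined (w ! i) a b) \<and> i < n \<and> joined (w ! i) c b \<longrightarrow> a = c" for i a b c
      using deg(2)[of i a b c] by simp
    show "\<not> ((i < n \<and> joined (w ! i) a True) \<and> Suc i < n \<and> joined (w ! Suc i) True b)" for i a b
      using joined_enters_extra[of "w ! i" a] step(2)[of i b] by blast
    show "\<not> ((i < n \<and> joined (w ! i) a True) \<and> Suc i < n \<and> fst (w ! Suc i))" for i a
      using joined_enters_extra[of "w ! i" a] step(1)[of i] by blast
    show "\<not> ((i < n \<and> joined (w ! i) True b) \<and> i < n \<and> fst (w ! i))" for i b
      using legal_excludes[OF leg[of i], of b] by blast
  qed
  moreover have "?A \<subseteq> {S. serpent (L n) S}"
  proof
    fix S assume "S \<in> ?A"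
    then consider i a b where "S = link n i a b" "i < n" "joined (w ! i) a b"
      | i where "S = stub n i" "i < n" "fst (w ! i)"
      unfolding realize_def by blast
    then show "S \<in> {S. serpent (L n) S}"
    proof cases
      case 1
      then show ?thesis using s1[OF 1(2,3)] serpent_L_iff[OF n] by blast
    next
      case 2
      then show ?thesis using s2[OF 2(2,3)] serpent_L_iff[OF n] by blast
    qed
  qed
  ultimately have "?A \<in> compatible_sets (L n)" unfolding compatible_L_iff[OF n] by blast
  moreover have "letter n ?A i = w ! i" if i: "i < n" for i
  proof -
    obtain v p q r s where l: "w ! i = (v, p, q, r, s)" by (rule prod_cases5)
    show ?thesis
      using joined_degrees(1-4)[OF leg[OF i, unfolded l]] i
      unfolding letter_def departs_def arrives_def linked stubbed l by simp
  qed
  then have "word n ?A = w" using len by (intro nth_equalityI) (auto simp: word_def)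
  ultimately show ?thesis by simp
qed

lemma card_option_bool:
  "card {t :: bool option. P t}
      = of_bool (P None) + of_bool (P (Some False)) + of_bool (P (Some True))"
proof -
  have "(\<Sum>t\<in>UNIV. f t) = f None + f (Some False) + f (Some True)" for f :: "bool option \<Rightarrow> nat"
    by (simp add: UNIV_option_conv UNIV_bool add.assoc)
  moreover have "card {t. P t} = (\<Sum>t\<in>UNIV. of_bool (P t))"
    by (simp add: sum_of_bool_eq)
  ultimately show ?thesis by presburger
qed

text \<open>Each link is determined by its left extremity, so the serpents correspond to the stubs and left
extremities recorded in the letters. In particular all members of a nest have the same cardinality.\<close>

lemma card_eq_weight:
  assumes n: "1 \<le> n" and A: "A \<in> compatible_sets (L n)"
  shows "card A = sum_list (map weight (word n A))"
proof -
  have sub: "A \<subseteq> {S. serpent (L n) S}" and nc: "noncolliding n A"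
    using A compatible_L_iff[OF n] by auto
  \<comment> \<open>A stub is encoded by \<open>None\<close>, a link by its left extremity.\<close>
  define D where "D = (SIGMA i:{..<n}. {t. case t of None \<Rightarrow> stubbed n A i | Some a \<Rightarrow> departs n A i a})"
  define g where "g = (\<lambda>(i, t). case t of None \<Rightarrow> stub n i | Some a \<Rightarrow> link n i a (THE b. linked n A i a b))"
  have the: "(THE b. linked n A i a b) = b" if "linked n A i a b" for i a b
    using that nc unfolding noncolliding_def by (intro the_equality) blast+
  have g_link: "\<exists>b. linked n A i a b \<and> g (i, Some a) = link n i a b" if "(i, Some a) \<in> D" for i a
    using that the unfolding D_def departs_def g_def by auto
  have g_stub: "stubbed n A i \<and> g (i, None) = stub n i" if "(i, None) \<in> D" for i
    using that unfolding D_def g_def by auto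
  have inj: "inj_on g D"
  proof (rule inj_onI)
    fix x y assume x: "x \<in> D" and y: "y \<in> D" and eq: "g x = g y"
    obtain i t j u where xy: "x = (i, t)" "y = (j, u)" by (cases x; cases y)
    show "x = y"
    proof (cases t)
      case None
      then have s: "site n i True" "g x = stub n i" using g_stub x xy by (auto simp: stubbed_def)
      show ?thesis
      proof (cases u)
        case None
        then have "site n j True" "g y = stub n j" using g_stub y xy by (auto simp: stubbed_def)
        then show ?thesis using eq s stub_eq_iff[OF n] xy \<open>t = None\<close> None by simp
      next
        case (Some c)
        obtain b where "site n j c" "site n (Suc j) b" "g y = link n j c b"
          using g_link[of j c] y unfolding xy Some linked_def by blast
        then show ?thesis using eq s link_neq_stub[OF n, of j c b i] by simp
      qed
    next
      case (Some a)
      obtain b where s: "site n i a" "site n (Suc i) b" "g x = link n i a b"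
        using g_link[of i a] x unfolding xy Some linked_def by blast
      show ?thesis
      proof (cases u)
        case None
        then have "site n j True" "g y = stub n j" using g_stub y xy by (auto simp: stubbed_def)
        then show ?thesis using eq s link_neq_stub[OF n, of i a b j] by simp
      next
        case u: (Some c)
        obtain d where t: "site n j c" "site n (Suc j) d" "g y = link n j c d"
          using g_link[of j c] y unfolding xy u linked_def by blast
        have "link n i a b = link n j c d" using eq s(3) t(3) by simp
        then show ?thesis unfolding link_eq_iff[OF n s(1,2) t(1,2)] xy Some u by simp
      qed
    qed
  qed
  have "g ` D = A"
  proof (intro equalityI subsetI)
    fix S assume "S \<in> g ` D"
    then obtain i t where it: "(i, t) \<in> D" "S = g (i, t)" by auto
    show "S \<in> A"
    proof (cases t)
      case None
      then show ?thesis using g_stub[of i] it unfolding stubbed_def by simp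
    next
      case (Some a)
      then obtain b where "linked n A i a b" "S = link n i a b" using g_link[of i a] it by auto
      then show ?thesis unfolding linked_def by simp
    qed
  next
    fix S assume "S \<in> A"
    with n sub show "S \<in> g ` D"
    proof (cases rule: serpentE)
      case (1 i a b)
      have "i < n" using 1(1) by (simp add: linked_def site_def)
      then have "(i, Some a) \<in> D" using 1(1) unfolding D_def departs_def by auto
      moreover have "g (i, Some a) = S" using 1(2) the[OF 1(1)] by (simp add: g_def)
      ultimately show ?thesis by blast
    next
      case (2 i)
      then have "(i, None) \<in> D" "g (i, None) = S"
        unfolding D_def g_def by (auto simp: stubbed_def site_def)
      then show ?thesis by blast
    qed
  qed
  then have "card A = card D" using card_image[OF inj] by simp
  also have "\<dots> = (\<Sum>i<n. card {t. case t of None \<Rightarrow> stubbed n A i | Some a \<Rightarrow> departs n A i a})"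
    unfolding D_def by (rule card_SigmaI) simp_all
  also have "\<dots> = (\<Sum>i<n. weight (letter n A i))"
    unfolding card_option_bool by (simp add: letter_def)
  also have "\<dots> = sum_list (map weight (word n A))"
    unfolding word_def map_map by (simp add: interv_sum_list_conv_sum_set_nat atLeast0LessThan)
  finally show ?thesis .
qed


section \<open>Counting words by a transfer matrix\<close>

lemma same_pattern_eq_word:
  assumes n: "1 \<le> n"
  shows "same_pattern (L n) = {(A, B). A \<in> compatible_sets (L n) \<and> B \<in> compatible_sets (L n)
      \<and> word n A = word n B}"
proof -
  have "(A, B) \<in> same_pattern (L n) \<longleftrightarrow>
      A \<in> compatible_sets (L n) \<and> B \<in> compatible_sets (L n) \<and> word n A = word n B" for A B
  proof (cases "A \<in> compatible_sets (L n) \<and> B \<in> compatible_sets (L n)")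
    case True
    then show ?thesis using same_pattern_L_iff[OF n, of A B] unfolding word_eq_iff by simp
  next
    case False
    then show ?thesis unfolding same_pattern_def by auto
  qed
  then show ?thesis by auto
qed

lemma sum_quotient_kernel:
  assumes "\<And>x. x \<in> C \<Longrightarrow> g {y \<in> C. f y = f x} = h (f x)"
  shows "(\<Sum>c\<in>C // {(x, y). x \<in> C \<and> y \<in> C \<and> f x = f y}. g c) = (\<Sum>w\<in>f ` C. h w)"
proof -
  let ?r = "{(x, y). x \<in> C \<and> y \<in> C \<and> f x = f y}"
  let ?fibre = "\<lambda>w. {y \<in> C. f y = w}"
  have "C // ?r = (\<lambda>x. ?r `` {x}) ` C" unfolding quotient_def by blast
  also have "\<dots> = (\<lambda>x. ?fibre (f x)) ` C" by (intro image_cong refl) auto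
  also have "\<dots> = ?fibre ` f ` C" by (simp add: image_image)
  finally have q: "C // ?r = ?fibre ` f ` C" .
  have inj: "inj_on ?fibre (f ` C)" by (rule inj_onI) blast
  show ?thesis unfolding q sum.reindex[OF inj] by (rule sum.cong) (use assms in auto)
qed

definition word_poly :: "bool \<Rightarrow> nat \<Rightarrow> int poly" where
  "word_poly b n = (\<Sum>w\<in>words b n. monom 1 (sum_list (map weight w)))"

lemma h_vector_L:
  assumes n: "1 \<le> n"
  shows "h_vector (L n) = word_poly True n"
proof -
  let ?C = "compatible_sets (L n)"
  have img: "word n ` ?C = words True n"
  proof (intro equalityI subsetI)
    fix w assume "w \<in> words True n"
    then have "realize n w \<in> ?C" "word n (realize n w) = w" using words_realized[OF n] by simp_all
    then show "w \<in> word n ` ?C" by (metis imageI)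
  qed (use word_in_words[OF n] in blast)
  have rk: "monom (1::int) (rk {B \<in> ?C. word n B = word n A})
      = monom 1 (sum_list (map weight (word n A)))"
    if A: "A \<in> ?C" for A
  proof -
    let ?X = "{B \<in> ?C. word n B = word n A}"
    have "card ` ?X = (\<lambda>_. sum_list (map weight (word n A))) ` ?X"
      by (rule image_cong[OF refl]) (simp add: card_eq_weight[OF n])
    also have "\<dots> = {sum_list (map weight (word n A))}"
      by (rule image_constant[of A]) (use A in simp)
    finally show ?thesis unfolding rk_def by simp
  qed
  show ?thesis
    unfolding h_vector_def serpent_nests_def same_pattern_eq_word[OF n] word_poly_def img[symmetric]
    by (rule sum_quotient_kernel) (rule rk)
qed

lemma finite_words: "finite (words b n)"
proof -
  have "words b n \<subseteq> {w. set w \<subseteq> UNIV \<and> length w = n}" by (auto simp: words_def)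
  then show ?thesis by (rule finite_subset) (rule finite_lists_length_eq[OF finite])
qed

lemma words_Suc: "words b (Suc n)
    = (\<lambda>(l, w). l # w) ` (SIGMA l:{l. legal b l}. words (enters_extra l) n)"
proof (intro equalityI subsetI)
  fix w assume w: "w \<in> words b (Suc n)"
  then obtain l u where lu: "w = l # u" by (cases w) (simp_all add: words_def)
  then have "(l, u) \<in> (SIGMA l:{l. legal b l}. words (enters_extra l) n)"
    using w by (simp add: words_def)
  then show "w \<in> (\<lambda>(l, w). l # w) ` (SIGMA l:{l. legal b l}. words (enters_extra l) n)"
    unfolding lu by (intro image_eqI[of _ _ "(l, u)"]) simp_all
next
  fix w assume "w \<in> (\<lambda>(l, w). l # w) ` (SIGMA l:{l. legal b l}. words (enters_extra l) n)"
  then obtain x where x: "x \<in> (SIGMA l:{l. legal b l}. words (enters_extra l) n)"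
    and w: "w = (\<lambda>(l, w). l # w) x" by (rule imageE)
  obtain l u where "x = (l, u)" by (cases x)
  then show "w \<in> words b (Suc n)" using x unfolding w by (simp add: words_def)
qed

lemma word_poly_Suc: "word_poly b (Suc n)
    = (\<Sum>l | legal b l. monom 1 (weight l) * word_poly (enters_extra l) n)"
proof -
  have inj: "inj_on (\<lambda>(l, w). l # w) X" for X :: "(letter \<times> letter list) set"
    by (auto simp: inj_on_def)
  have "word_poly b (Suc n) = (\<Sum>(l, w)\<in>(SIGMA l:{l. legal b l}. words (enters_extra l) n).
      monom 1 (weight l) * monom 1 (sum_list (map weight w)))"
    unfolding word_poly_def words_Suc sum.reindex[OF inj]
    by (rule sum.cong[OF refl]) (simp add: mult_monom split: prod.split)
  also have "\<dots> = (\<Sum>l | legal b l. \<Sum>w\<in>words (enters_extra l) n.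
      monom 1 (weight l) * monom 1 (sum_list (map weight w)))"
    by (rule sum.Sigma[symmetric]) (simp_all add: finite_words)
  finally show ?thesis unfolding word_poly_def sum_distrib_left .
qed

lemma legal_True: "{l. legal True l} =
  {(False, False, False, False, False), (False, True, False, True, False), (False, True, False, False, True)}"
proof -
  have "legal True (v, p, q, r, s) \<longleftrightarrow> (v, p, q, r, s) \<in>
      {(False, False, False, False, False), (False, True, False, True, False), (False, True, False, False, True)}"
    for v p q r s by (cases v; cases p; cases q; cases r; cases s) simp_all
  then show ?thesis by (intro set_eqI) (metis mem_Collect_eq prod_cases5)
qed

lemma legal_False: "{l. legal False l} =
  {(False, False, False, False, False), (False, True, False, True, False), (False, True, False, False, True),
   (True, False, False, False, False), (True, True, False, True, False), (True, True, False, False, True),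
   (False, False, True, True, False), (False, False, True, False, True), (False, True, True, True, True)}"
proof -
  have "legal False (v, p, q, r, s) \<longleftrightarrow> (v, p, q, r, s) \<in>
  {(False, False, False, False, False), (False, True, False, True, False), (False, True, False, False, True),
   (True, False, False, False, False), (True, True, False, True, False), (True, True, False, False, True),
   (False, False, True, True, False), (False, False, True, False, True), (False, True, True, True, True)}"
    for v p q r s by (cases v; cases p; cases q; cases r; cases s) simp_all
  then show ?thesis by (intro set_eqI) (metis mem_Collect_eq prod_cases5)
qed

lemma monom_1_eq_power: "monom (1::int) k = [:0, 1:] ^ k"
  by (simp add: monom_altdef)

lemma word_poly_transfer:
  fixes x :: "int poly"
  defines "x \<equiv> [:0, 1:]"
  shows "word_poly True (Suc n) = (1 + x) * word_poly False n + x * word_poly True n"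
    and "word_poly False (Suc n)
        = (1 + 3 * x + x ^ 2) * word_poly False n + (2 * x + 2 * x ^ 2) * word_poly True n"
  unfolding word_poly_Suc legal_True legal_False x_def monom_1_eq_power
  by (simp_all add: algebra_simps power2_eq_square)

lemma word_poly_0: "word_poly False 0 = 1" "word_poly True 0 = 0"
proof -
  have "words False 0 = {[]}" "words True 0 = {}" by (auto simp: words_def)
  then show "word_poly False 0 = 1" "word_poly True 0 = 0" by (simp_all add: word_poly_def)
qed

lemma lucas_h_eq_word_poly: "lucas_h n = word_poly True n"
  using h_vector_L[of n] word_poly_0 by (cases "n = 0") (simp_all add: lucas_h_def)

theorem proposition4p7:
  shows "lucas_h 1 = [:1, 1:] \<and>
    (\<forall>n. lucas_h (n + 2) =
      [:1, 4, 1:] * lucas_h (n + 1) + [:0, 1:] * [:1, 1, 1:] * lucas_h n)"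
proof (intro conjI allI)
  let ?x = "[:0, 1:] :: int poly"
  have poly: "[:1, 4, 1:] = 1 + 4 * ?x + ?x ^ 2" "[:1, 1, 1:] = 1 + ?x + ?x ^ 2"
    by (simp_all add: power2_eq_square numeral_poly one_pCons)
  show "lucas_h 1 = [:1, 1:]" unfolding lucas_h_eq_word_poly using word_poly_transfer(1)[of 0]
      by (simp add: word_poly_0 one_pCons)
  fix n
  show "lucas_h (n + 2) = [:1, 4, 1:] * lucas_h (n + 1) + [:0, 1:] * [:1, 1, 1:] * lucas_h n"
    unfolding lucas_h_eq_word_poly poly
    using word_poly_transfer(1)[of "Suc n"] word_poly_transfer[of n]
        by (simp add: algebra_simps power2_eq_square)
qed

end
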